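(* Every instance admits a machine-optimal relaxed unsplit stable assignment $x_{\text{mopt}}$, and it can be computed in $O(|E|)$ time.
   Context: An instance consists of a finite bipartite graph $G=(J\cup M,E)$ between a set $J$ of jobs and a set $M$ of machines; each job $j$ has a size $q(j)>0$ and each machine $m$ a capacity $q(m)>0$. Every job has a strict preference order over its adjacent machines and every machine has a strict preference order over its adjacent jobs. $M$ contains a dummy machine $m_d$ adjacent to every job, ranked last by every job, with capacity $q(m_d)>\sum_{j\in J}q(j)$. An assignment is $x:E\to\mathbb{R}_{\ge 0}$, with $x(j)=\sum_m x(jm)$, $x(m)=\sum_j x(jm)$. It is unsplit if $x(jm)\in\{0,q(j)\}$ for all $jm\in E$ and $x(j)\le q(j)$ for all jobs. An unsplit $x$ is a relaxed unsplit assignment if for every machine $m$ with at least one assigned job, $x(m)-q(j_m)<q(m)$ where $j_m$ is the assigned job that $m$ likes least. A relaxed unsplit assignment $x$ is stable if for every edge $jm$ with $x(jm)=0$, either $j$ is assigned to a machine it prefers to $m$, or $\sum_{j' : m\text{ prefers } j' \text{ to } j}x(j'm)\ge q(m)$. For unsplit $x_1,x_2$, machine $m$ weakly prefers $x_1$ to $x_2$ if either no edge incident to $m$ is positive in exactly one of $x_1,x_2$, or the edge $m$ ranks best among edges incident to $m$ that are positive in exactly one of $x_1,x_2$ is positive in $x_1$. A relaxed unsplit stable assignment is machine-optimal if every machine weakly prefers it to every relaxed unsplit stable assignment. *)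

theory Defs
  imports Complex_Main "HOL-Library.Landau_Symbols"
begin

section \<open>Instances\<close>

text \<open>
  \<open>(m, m') \<in> jpref I j\<close> means that job \<open>j\<close> prefers \<open>m\<close> to \<open>m'\<close>, and
  \<open>(j, j') \<in> mpref I m\<close> that machine \<open>m\<close> prefers \<open>j\<close> to \<open>j'\<close>.
\<close>

record ('j, 'm) problem =
  jobs :: "'j set"
  machines :: "'m set"
  edges :: "('j \<times> 'm) set"
  jsize :: "'j \<Rightarrow> real"
  mcap :: "'m \<Rightarrow> real"
  jpref :: "'j \<Rightarrow> ('m \<times> 'm) set"
  mpref :: "'m \<Rightarrow> ('j \<times> 'j) set"
  dummy :: "'m"

definition adj_machines :: "('j, 'm) problem \<Rightarrow> 'j \<Rightarrow> 'm set" where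
  "adj_machines I j = {m. (j, m) \<in> edges I}"

definition adj_jobs :: "('j, 'm) problem \<Rightarrow> 'm \<Rightarrow> 'j set" where
  "adj_jobs I m = {j. (j, m) \<in> edges I}"

definition strict_preference_on :: "'a set \<Rightarrow> ('a \<times> 'a) set \<Rightarrow> bool" where
  "strict_preference_on A r \<longleftrightarrow> r \<subseteq> A \<times> A \<and> strict_linear_order_on A r"

definition valid_problem :: "('j, 'm) problem \<Rightarrow> bool" where
  "valid_problem I \<longleftrightarrow>
     finite (jobs I) \<and> finite (machines I) \<and> edges I \<subseteq> jobs I \<times> machines I \<and>
     (\<forall>j\<in>jobs I. jsize I j > 0) \<and> (\<forall>m\<in>machines I. mcap I m > 0) \<and>
     (\<forall>j\<in>jobs I. strict_preference_on (adj_machines I j) (jpref I j)) \<and>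
     (\<forall>m\<in>machines I. strict_preference_on (adj_jobs I m) (mpref I m)) \<and>
     dummy I \<in> machines I \<and>
     (\<forall>j\<in>jobs I. (j, dummy I) \<in> edges I \<and>
        (\<forall>m\<in>adj_machines I j. m \<noteq> dummy I \<longrightarrow> (m, dummy I) \<in> jpref I j)) \<and>
     mcap I (dummy I) > (\<Sum>j\<in>jobs I. jsize I j)"

section \<open>Assignments\<close>

text \<open>Only the values of \<open>x\<close> on \<open>edges I\<close> are relevant.\<close>

definition assignment :: "('j, 'm) problem \<Rightarrow> ('j \<times> 'm \<Rightarrow> real) \<Rightarrow> bool" where
  "assignment I x \<longleftrightarrow> (\<forall>e\<in>edges I. x e \<ge> 0)"

definition job_total :: "('j, 'm) problem \<Rightarrow> ('j \<times> 'm \<Rightarrow> real) \<Rightarrow> 'j \<Rightarrow> real" where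
  "job_total I x j = (\<Sum>m\<in>adj_machines I j. x (j, m))"

definition machine_total :: "('j, 'm) problem \<Rightarrow> ('j \<times> 'm \<Rightarrow> real) \<Rightarrow> 'm \<Rightarrow> real" where
  "machine_total I x m = (\<Sum>j\<in>adj_jobs I m. x (j, m))"

definition unsplit :: "('j, 'm) problem \<Rightarrow> ('j \<times> 'm \<Rightarrow> real) \<Rightarrow> bool" where
  "unsplit I x \<longleftrightarrow> assignment I x \<and>
     (\<forall>(j, m)\<in>edges I. x (j, m) \<in> {0, jsize I j}) \<and>
     (\<forall>j\<in>jobs I. job_total I x j \<le> jsize I j)"

definition assigned_jobs :: "('j, 'm) problem \<Rightarrow> ('j \<times> 'm \<Rightarrow> real) \<Rightarrow> 'm \<Rightarrow> 'j set" where
  "assigned_jobs I x m = {j \<in> adj_jobs I m. x (j, m) > 0}"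

definition best_in :: "('a \<times> 'a) set \<Rightarrow> 'a set \<Rightarrow> 'a \<Rightarrow> bool" where
  "best_in r A a \<longleftrightarrow> a \<in> A \<and> (\<forall>b\<in>A. b \<noteq> a \<longrightarrow> (a, b) \<in> r)"

definition worst_in :: "('a \<times> 'a) set \<Rightarrow> 'a set \<Rightarrow> 'a \<Rightarrow> bool" where
  "worst_in r A a \<longleftrightarrow> a \<in> A \<and> (\<forall>b\<in>A. b \<noteq> a \<longrightarrow> (b, a) \<in> r)"

definition relaxed_unsplit :: "('j, 'm) problem \<Rightarrow> ('j \<times> 'm \<Rightarrow> real) \<Rightarrow> bool" where
  "relaxed_unsplit I x \<longleftrightarrow> unsplit I x \<and>
     (\<forall>m\<in>machines I. \<forall>j. worst_in (mpref I m) (assigned_jobs I x m) j \<longrightarrow>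
        machine_total I x m - jsize I j < mcap I m)"

definition relaxed_unsplit_stable :: "('j, 'm) problem \<Rightarrow> ('j \<times> 'm \<Rightarrow> real) \<Rightarrow> bool" where
  "relaxed_unsplit_stable I x \<longleftrightarrow> relaxed_unsplit I x \<and>
     (\<forall>(j, m)\<in>edges I. x (j, m) = 0 \<longrightarrow>
        (\<exists>m'\<in>adj_machines I j. x (j, m') > 0 \<and> (m', m) \<in> jpref I j) \<or>
        (\<Sum>j' | j' \<in> adj_jobs I m \<and> (j', j) \<in> mpref I m. x (j', m)) \<ge> mcap I m)"

definition weakly_prefers ::
  "('j, 'm) problem \<Rightarrow> 'm \<Rightarrow> ('j \<times> 'm \<Rightarrow> real) \<Rightarrow> ('j \<times> 'm \<Rightarrow> real) \<Rightarrow> bool" where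
  "weakly_prefers I m x1 x2 \<longleftrightarrow>
     (let D = {j \<in> adj_jobs I m. (x1 (j, m) > 0) \<noteq> (x2 (j, m) > 0)}
      in D = {} \<or> (\<exists>j. best_in (mpref I m) D j \<and> x1 (j, m) > 0))"

definition machine_optimal :: "('j, 'm) problem \<Rightarrow> ('j \<times> 'm \<Rightarrow> real) \<Rightarrow> bool" where
  "machine_optimal I x \<longleftrightarrow> relaxed_unsplit_stable I x \<and>
     (\<forall>m\<in>machines I. \<forall>y. relaxed_unsplit_stable I y \<longrightarrow> weakly_prefers I m x y)"

section \<open>Model of computation\<close>

text \<open>
  A unit-cost random access machine, programmed in a while language. A program works on
  finitely many arrays of natural numbers and finitely many arrays of reals, named by numerals;
  a scalar variable is a fixed cell of some array. The only arithmetic on naturals is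
  successor and predecessor, so the numbers computed in \<open>t\<close> steps exceed those in the initial
  memory by at most \<open>t\<close> plus a constant. The only operations on reals are addition, subtraction and
  comparison. Every node of an expression costs one time unit, every store or test one more.
\<close>

record mem =
  nmem :: "nat \<Rightarrow> nat \<Rightarrow> nat"
  rmem :: "nat \<Rightarrow> nat \<Rightarrow> real"

datatype nexp = NConst nat | NCell nat nexp | NSucc nexp | NPred nexp

datatype rexp = RZero | RCell nat nexp | RAdd rexp rexp | RSub rexp rexp

datatype bexp = NLess nexp nexp | RLess rexp rexp | BNot bexp | BAnd bexp bexp

datatype com =
    Skip
  | NStore nat nexp nexp
  | RStore nat nexp rexp
  | Seq com com
  | Cond bexp com com
  | While bexp com

primrec nval :: "nexp \<Rightarrow> mem \<Rightarrow> nat" where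
  "nval (NConst k) s = k"
| "nval (NCell a i) s = nmem s a (nval i s)"
| "nval (NSucc e) s = nval e s + 1"
| "nval (NPred e) s = nval e s - 1"

primrec rval :: "rexp \<Rightarrow> mem \<Rightarrow> real" where
  "rval RZero s = 0"
| "rval (RCell a i) s = rmem s a (nval i s)"
| "rval (RAdd e f) s = rval e s + rval f s"
| "rval (RSub e f) s = rval e s - rval f s"

primrec bval :: "bexp \<Rightarrow> mem \<Rightarrow> bool" where
  "bval (NLess e f) s = (nval e s < nval f s)"
| "bval (RLess e f) s = (rval e s < rval f s)"
| "bval (BNot b) s = (\<not> bval b s)"
| "bval (BAnd b c) s = (bval b s \<and> bval c s)"

primrec ncost :: "nexp \<Rightarrow> nat" where
  "ncost (NConst k) = 1"
| "ncost (NCell a i) = ncost i + 1"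
| "ncost (NSucc e) = ncost e + 1"
| "ncost (NPred e) = ncost e + 1"

primrec rcost :: "rexp \<Rightarrow> nat" where
  "rcost RZero = 1"
| "rcost (RCell a i) = ncost i + 1"
| "rcost (RAdd e f) = rcost e + rcost f + 1"
| "rcost (RSub e f) = rcost e + rcost f + 1"

primrec bcost :: "bexp \<Rightarrow> nat" where
  "bcost (NLess e f) = ncost e + ncost f + 1"
| "bcost (RLess e f) = rcost e + rcost f + 1"
| "bcost (BNot b) = bcost b + 1"
| "bcost (BAnd b c) = bcost b + bcost c + 1"

definition nupd :: "nat \<Rightarrow> nat \<Rightarrow> nat \<Rightarrow> mem \<Rightarrow> mem" where
  "nupd a i v s = s\<lparr>nmem := (nmem s)(a := (nmem s a)(i := v))\<rparr>"

definition rupd :: "nat \<Rightarrow> nat \<Rightarrow> real \<Rightarrow> mem \<Rightarrow> mem" where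
  "rupd a i v s = s\<lparr>rmem := (rmem s)(a := (rmem s a)(i := v))\<rparr>"

text \<open>\<open>exec c s t s'\<close>: started in memory \<open>s\<close>, the program \<open>c\<close> halts after \<open>t\<close> time units
  with memory \<open>s'\<close>.\<close>

inductive exec :: "com \<Rightarrow> mem \<Rightarrow> nat \<Rightarrow> mem \<Rightarrow> bool" where
  exec_Skip: "exec Skip s 1 s"
| exec_NStore: "exec (NStore a i e) s (ncost i + ncost e + 1) (nupd a (nval i s) (nval e s) s)"
| exec_RStore: "exec (RStore a i e) s (ncost i + rcost e + 1) (rupd a (nval i s) (rval e s) s)"
| exec_Seq: "exec c s t s' \<Longrightarrow> exec d s' u s'' \<Longrightarrow> exec (Seq c d) s (t + u) s''"
| exec_CondT: "bval b s \<Longrightarrow> exec c s t s' \<Longrightarrow> exec (Cond b c d) s (bcost b + t + 1) s'"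
| exec_CondF: "\<not> bval b s \<Longrightarrow> exec d s t s' \<Longrightarrow> exec (Cond b c d) s (bcost b + t + 1) s'"
| exec_WhileF: "\<not> bval b s \<Longrightarrow> exec (While b c) s (bcost b + 1) s"
| exec_WhileT: "bval b s \<Longrightarrow> exec c s t s' \<Longrightarrow> exec (While b c) s' u s'' \<Longrightarrow>
    exec (While b c) s (bcost b + t + u + 1) s''"

inductive_cases exec_SkipE: "exec Skip s t s'"
inductive_cases exec_NStoreE: "exec (NStore a i e) s t s'"
inductive_cases exec_RStoreE: "exec (RStore a i e) s t s'"
inductive_cases exec_SeqE: "exec (Seq c d) s t s'"
inductive_cases exec_CondE: "exec (Cond b c d) s t s'"
inductive_cases exec_WhileE: "exec (While b c) s t s'"

lemma exec_deterministic:
  "exec c s t s' \<Longrightarrow> exec c s u r \<Longrightarrow> u = t \<and> r = s'"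
proof (induction arbitrary: u r rule: exec.induct)
  case (exec_Skip s)
  then show ?case by (auto elim: exec_SkipE)
next
  case (exec_NStore a i e s)
  then show ?case by (auto elim: exec_NStoreE)
next
  case (exec_RStore a i e s)
  then show ?case by (auto elim: exec_RStoreE)
next
  case (exec_Seq c s t s' d v s'')
  from exec_Seq.prems show ?case
    by (rule exec_SeqE) (metis exec_Seq.IH)
next
  case (exec_CondT b s c t s' d)
  from exec_CondT.prems show ?case
    by (rule exec_CondE) (metis exec_CondT.hyps(1) exec_CondT.IH Suc_eq_plus1)+
next
  case (exec_CondF b s d t s' c)
  from exec_CondF.prems show ?case
    by (rule exec_CondE) (metis exec_CondF.hyps(1) exec_CondF.IH Suc_eq_plus1)+
next
  case (exec_WhileF b s c)
  from exec_WhileF.prems show ?case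
    by (rule exec_WhileE) (simp_all add: exec_WhileF.hyps)
next
  case (exec_WhileT b s c t s' v s'')
  from exec_WhileT.prems show ?case
    by (rule exec_WhileE) (metis exec_WhileT.hyps(1) exec_WhileT.IH Suc_eq_plus1)+
qed

section \<open>Representation of instances in memory\<close>

text \<open>
  Jobs, machines and edges are numbered from 0, the first two by \<open>jn\<close> and \<open>mn\<close>. The graph is
  stored by its edges (end points in arrays 5 and 6) together with the incidence list of every
  vertex, which contains edge numbers sorted by decreasing preference. The incidence list of
  vertex \<open>i\<close> occupies the cells \<open>off i, ..., off (i + 1) - 1\<close> of the list array.
  All other cells may initially hold arbitrary values.

  \<^item> naturals, array 0: number of jobs, of machines, of edges in cells 0, 1, 2
  \<^item> naturals, arrays 1 and 2: offsets and incidence lists of the jobs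
  \<^item> naturals, arrays 3 and 4: offsets and incidence lists of the machines
  \<^item> naturals, arrays 5 and 6: job and machine of each edge
  \<^item> reals, arrays 0 and 1: job sizes and machine capacities
\<close>

definition edge_at :: "(nat \<Rightarrow> 'j) \<Rightarrow> (nat \<Rightarrow> 'm) \<Rightarrow> mem \<Rightarrow> nat \<Rightarrow> 'j \<times> 'm" where
  "edge_at jn mn s e = (jn (nmem s 5 e), mn (nmem s 6 e))"

definition incidence_lists ::
  "nat \<Rightarrow> nat \<Rightarrow> (nat \<Rightarrow> nat) \<Rightarrow> (nat \<Rightarrow> nat \<Rightarrow> nat \<Rightarrow> bool) \<Rightarrow> (nat \<Rightarrow> nat) \<Rightarrow> (nat \<Rightarrow> nat) \<Rightarrow> bool"
where
  "incidence_lists nv ne endpoint better off lst \<longleftrightarrow> off 0 = 0 \<and>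
     (\<forall>i<nv. off i \<le> off (i + 1) \<and>
        (let es = map lst [off i..<off (i + 1)]
         in set es = {e. e < ne \<and> endpoint e = i} \<and> sorted_wrt (better i) es))"

definition represents ::
  "('j, 'm) problem \<Rightarrow> (nat \<Rightarrow> 'j) \<Rightarrow> (nat \<Rightarrow> 'm) \<Rightarrow> mem \<Rightarrow> bool" where
  "represents I jn mn s \<longleftrightarrow>
     (let nj = nmem s 0 0; nm = nmem s 0 1; ne = nmem s 0 2
      in bij_betw jn {..<nj} (jobs I) \<and>
         bij_betw mn {..<nm} (machines I) \<and>
         (\<forall>e<ne. nmem s 5 e < nj \<and> nmem s 6 e < nm) \<and>
         bij_betw (edge_at jn mn s) {..<ne} (edges I) \<and>
         incidence_lists nj ne (nmem s 5)
           (\<lambda>i e e'. (mn (nmem s 6 e), mn (nmem s 6 e')) \<in> jpref I (jn i)) (nmem s 1) (nmem s 2) \<and>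
         incidence_lists nm ne (nmem s 6)
           (\<lambda>i e e'. (jn (nmem s 5 e), jn (nmem s 5 e')) \<in> mpref I (mn i)) (nmem s 3) (nmem s 4) \<and>
         (\<forall>i<nj. rmem s 0 i = jsize I (jn i)) \<and>
         (\<forall>i<nm. rmem s 1 i = mcap I (mn i)))"

text \<open>The result is delivered in array 2 of reals, indexed by the edge numbers of the input
  memory \<open>s\<close>.\<close>

definition delivers ::
  "('j, 'm) problem \<Rightarrow> (nat \<Rightarrow> 'j) \<Rightarrow> (nat \<Rightarrow> 'm) \<Rightarrow> mem \<Rightarrow> mem \<Rightarrow> ('j \<times> 'm \<Rightarrow> real) \<Rightarrow> bool" where
  "delivers I jn mn s s' x \<longleftrightarrow> (\<forall>e < card (edges I). rmem s' 2 e = x (edge_at jn mn s e))"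

end

theory Submission
  imports Defs
begin

text \<open>
  Machines propose to jobs in decreasing order of preference as long as the jobs that they hold
  do not fill their capacity; a job keeps the best proposal it has received. No proposal that
  belongs to some stable assignment \<open>y\<close> is ever rejected: if \<open>j\<close> were the first to reject such an
  \<open>m\<close>, in favour of \<open>m'\<close>, then stability of \<open>y\<close> says that \<open>m'\<close> is filled in \<open>y\<close> by jobs it prefers
  to \<open>j\<close>; all of these have been proposed to and none has rejected \<open>m'\<close>, so \<open>m'\<close> would
  have been full before proposing to \<open>j\<close>. Hence, at the best job on which the result and
  \<open>y\<close> differ at \<open>m\<close>, the result must be the one that is positive.

  For the running time, a stack holds the machines that may still have to propose. Each step
  either pops the stack or makes a proposal, which pushes at most one machine (the one that loses
  its job), so twice the number of unproposed edges plus the height of the stack decreases.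
\<close>

section \<open>Strict preference orders\<close>

lemma strict_preference_on_irrefl: "strict_preference_on A r \<Longrightarrow> (a, a) \<notin> r"
  by (auto simp: strict_preference_on_def strict_linear_order_on_def irrefl_def)

lemma strict_preference_on_trans:
  "strict_preference_on A r \<Longrightarrow> (a, b) \<in> r \<Longrightarrow> (b, c) \<in> r \<Longrightarrow> (a, c) \<in> r"
  unfolding strict_preference_on_def strict_linear_order_on_def by (meson transD)

lemma strict_preference_on_asym: "strict_preference_on A r \<Longrightarrow> (a, b) \<in> r \<Longrightarrow> (b, a) \<notin> r"
  using strict_preference_on_irrefl strict_preference_on_trans by metis

lemma strict_preference_on_total:
  "strict_preference_on A r \<Longrightarrow> a \<in> A \<Longrightarrow> b \<in> A \<Longrightarrow> a \<noteq> b \<Longrightarrow> (a, b) \<in> r \<or> (b, a) \<in> r"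
  by (auto simp: strict_preference_on_def strict_linear_order_on_def total_on_def)

lemma strict_preference_on_converse:
  "strict_preference_on A r \<Longrightarrow> strict_preference_on A (r\<inverse>)"
  by (auto simp: strict_preference_on_def strict_linear_order_on_def)

text \<open>Induction on the finite set: a new element either loses to the previous best one or, by
  transitivity, beats everything.\<close>

lemma best_in_exists:
  assumes "strict_preference_on B r" "finite A" "A \<noteq> {}" "A \<subseteq> B"
  obtains a where "best_in r A a"
proof -
  from assms(2-4) have "\<exists>a. best_in r A a"
  proof (induction A rule: finite_ne_induct)
    case (singleton a)
    then show ?case by (auto simp: best_in_def)
  next
    case (insert b A)
    then obtain a where a: "best_in r A a" by auto
    then have "a \<noteq> b" "a \<in> B" "b \<in> B" using insert by (auto simp: best_in_def)
    with assms(1) consider "(a, b) \<in> r" | "(b, a) \<in> r"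
      using strict_preference_on_total by metis
    then show ?case
    proof cases
      case 1
      then show ?thesis using a by (auto simp: best_in_def)
    next
      case 2
      then have "best_in r (insert b A) b"
        using a strict_preference_on_trans[OF assms(1) 2] by (auto simp: best_in_def)
      then show ?thesis ..
    qed
  qed
  then show thesis using that by blast
qed

lemma best_in_not_better:
  assumes "strict_preference_on B r" "best_in r A a" "b \<in> A"
  shows "(b, a) \<notin> r"
  using assms strict_preference_on_irrefl strict_preference_on_asym unfolding best_in_def by metis

lemma worst_in_not_better:
  assumes "strict_preference_on B r" "worst_in r A a" "b \<in> A"
  shows "(a, b) \<notin> r"
  using assms strict_preference_on_irrefl strict_preference_on_asym unfolding worst_in_def by metis

lemma worst_in_exists:
  assumes "strict_preference_on B r" "finite A" "A \<noteq> {}" "A \<subseteq> B"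
  obtains a where "worst_in r A a"
proof -
  obtain a where "best_in (r\<inverse>) A a"
    using best_in_exists[OF strict_preference_on_converse[OF assms(1)] assms(2-4)] .
  then show thesis using that by (auto simp: best_in_def worst_in_def)
qed

section \<open>Deferred acceptance on sets of proposed edges\<close>

text \<open>This is the sum in the saturation alternative of \<open>relaxed_unsplit_stable\<close>.
  Relaxed feasibility is also rephrased as a bound on it.\<close>

definition better_load :: "('j, 'm) problem \<Rightarrow> ('j \<times> 'm \<Rightarrow> real) \<Rightarrow> 'j \<Rightarrow> 'm \<Rightarrow> real" where
  "better_load I x j m = (\<Sum>j' | j' \<in> adj_jobs I m \<and> (j', j) \<in> mpref I m. x (j', m))"

text \<open>\<open>P\<close> is the set of edges along which a machine has proposed so far; every job holds its
  best proposal, so \<open>P - held I P\<close> are the rejected ones.\<close>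

definition held :: "('j, 'm) problem \<Rightarrow> ('j \<times> 'm) set \<Rightarrow> ('j \<times> 'm) set" where
  "held I P = {(j, m) \<in> P. \<forall>m'. (j, m') \<in> P \<longrightarrow> (m', m) \<notin> jpref I j}"

definition held_assignment ::
  "('j, 'm) problem \<Rightarrow> ('j \<times> 'm) set \<Rightarrow> 'j \<times> 'm \<Rightarrow> real" where
  "held_assignment I P e = (if e \<in> held I P then jsize I (fst e) else 0)"

text \<open>The second clause makes the proposals of each machine a prefix of its preference list.
  The third counts only jobs preferred to the held one: it finally yields the relaxed capacity
  condition, and later proposals of the same machine, which go to less preferred jobs, cannot spoil
  it. The last clause treats all stable assignments \<open>y\<close> at once.\<close>

definition proposal_invariant :: "('j, 'm) problem \<Rightarrow> ('j \<times> 'm) set \<Rightarrow> bool" where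
  "proposal_invariant I P \<longleftrightarrow> P \<subseteq> edges I \<and>
     (\<forall>j m j'. (j, m) \<in> P \<and> (j', j) \<in> mpref I m \<longrightarrow> (j', m) \<in> P) \<and>
     (\<forall>(j, m) \<in> held I P. better_load I (held_assignment I P) j m < mcap I m) \<and>
     (\<forall>y e. relaxed_unsplit_stable I y \<and> e \<in> P - held I P \<longrightarrow> y e = 0)"

section \<open>Basic consequences of validity\<close>

locale valid_instance =
  fixes I :: "('j, 'm) problem"
  assumes valid: "valid_problem I"
begin

lemma edges_subset: "(j, m) \<in> edges I \<Longrightarrow> j \<in> jobs I \<and> m \<in> machines I"
  using valid by (auto simp: valid_problem_def)

lemma finite_edges: "finite (edges I)"
  using valid by (auto simp: valid_problem_def intro: finite_subset)

lemma finite_adj_jobs: "finite (adj_jobs I m)"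
  by (rule finite_subset[of _ "fst ` edges I"]) (force simp: adj_jobs_def finite_edges)+

lemma finite_adj_machines: "finite (adj_machines I j)"
  by (rule finite_subset[of _ "snd ` edges I"]) (force simp: adj_machines_def finite_edges)+

lemma jsize_pos: "(j, m) \<in> edges I \<Longrightarrow> jsize I j > 0"
  using valid by (auto simp: valid_problem_def)

lemma job_order: "j \<in> jobs I \<Longrightarrow> strict_preference_on (adj_machines I j) (jpref I j)"
  using valid by (auto simp: valid_problem_def)

lemma machine_order: "m \<in> machines I \<Longrightarrow> strict_preference_on (adj_jobs I m) (mpref I m)"
  using valid by (auto simp: valid_problem_def)

lemma mpref_edge: "m \<in> machines I \<Longrightarrow> (j, j') \<in> mpref I m \<Longrightarrow> (j, m) \<in> edges I"
  using machine_order by (fastforce simp: strict_preference_on_def adj_jobs_def)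

section \<open>Held proposals\<close>

lemma held_subset: "held I P \<subseteq> P"
  by (auto simp: held_def)

lemma held_unique:
  assumes "P \<subseteq> edges I" "(j, m) \<in> held I P" "(j, m') \<in> held I P"
  shows "m = m'"
proof (rule ccontr)
  assume "m \<noteq> m'"
  moreover have "m \<in> adj_machines I j" "m' \<in> adj_machines I j" "j \<in> jobs I"
    using assms held_subset edges_subset by (auto simp: adj_machines_def held_def)
  ultimately have "(m, m') \<in> jpref I j \<or> (m', m) \<in> jpref I j"
    using strict_preference_on_total[OF job_order] by blast
  then show False using assms(2,3) by (auto simp: held_def)
qed

lemma held_exists:
  assumes "P \<subseteq> edges I" "(j, m) \<in> P"
  obtains m' where "(j, m') \<in> held I P" "m' = m \<or> (m', m) \<in> jpref I j"
proof -
  let ?A = "{m. (j, m) \<in> P}"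
  have A: "?A \<subseteq> adj_machines I j" using assms by (auto simp: adj_machines_def)
  have j: "j \<in> jobs I" using assms edges_subset by blast
  obtain m' where m': "best_in (jpref I j) ?A m'"
    using best_in_exists[OF job_order[OF j] _ _ A] assms(2) finite_subset[OF A finite_adj_machines]
    by blast
  show thesis
  proof (rule that)
    show "(j, m') \<in> held I P"
      using m' best_in_not_better[OF job_order[OF j] m'] by (auto simp: held_def best_in_def)
    show "m' = m \<or> (m', m) \<in> jpref I j" using m' assms(2) by (auto simp: best_in_def)
  qed
qed

lemma held_insert_other: "j' \<noteq> j \<Longrightarrow> (j', m') \<in> held I (insert (j, m) P) \<longleftrightarrow> (j', m') \<in> held I P"
  by (auto simp: held_def)

lemma held_insert_subset: "held I (insert (j, m) P) \<subseteq> insert (j, m) (held I P)"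
  by (auto simp: held_def)

section \<open>Unsplit assignments and loads\<close>

lemma unsplit_value:
  "unsplit I y \<Longrightarrow> (j, m) \<in> edges I \<Longrightarrow> y (j, m) = 0 \<or> y (j, m) = jsize I j"
  by (auto simp: unsplit_def)

lemma unsplit_nonneg: "unsplit I y \<Longrightarrow> e \<in> edges I \<Longrightarrow> y e \<ge> 0"
  by (auto simp: unsplit_def assignment_def)

lemma unsplit_unique:
  assumes y: "unsplit I y" and e: "(j, m) \<in> edges I" "(j, m') \<in> edges I"
    and pos: "y (j, m) > 0" "y (j, m') > 0"
  shows "m = m'"
proof (rule ccontr)
  assume ne: "m \<noteq> m'"
  have v: "y (j, m) = jsize I j" "y (j, m') = jsize I j"
    using unsplit_value[OF y] e pos by (metis less_irrefl)+
  have "(\<Sum>k\<in>{m, m'}. y (j, k)) \<le> job_total I y j"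
    unfolding job_total_def
    by (rule sum_mono2[OF finite_adj_machines])
      (use e unsplit_nonneg[OF y] in \<open>auto simp: adj_machines_def\<close>)
  also have "\<dots> \<le> jsize I j" using y e edges_subset by (auto simp: unsplit_def)
  finally show False using ne v pos by simp
qed

text \<open>Since \<open>j\<close> is assigned to \<open>m\<close>, the least liked assigned job
  \<open>w\<close> is not preferred to \<open>j\<close>. So the better load misses at least the size
  of \<open>w\<close>, and relaxed feasibility bounds what remains.\<close>

lemma relaxed_unsplit_better_load:
  assumes y: "relaxed_unsplit I y" and e: "(j, m) \<in> edges I" and pos: "y (j, m) > 0"
  shows "better_load I y j m < mcap I m"
proof -
  have u: "unsplit I y" using y by (simp add: relaxed_unsplit_def)
  have m: "m \<in> machines I" using e edges_subset by blast
  let ?A = "assigned_jobs I y m"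
  have "?A \<subseteq> adj_jobs I m" "?A \<noteq> {}" "finite ?A"
    using e pos finite_adj_jobs by (auto simp: assigned_jobs_def adj_jobs_def)
  then obtain w where w: "worst_in (mpref I m) ?A w"
    using worst_in_exists[OF machine_order[OF m]] by blast
  then have wadj: "w \<in> adj_jobs I m" and wpos: "y (w, m) > 0"
    by (auto simp: worst_in_def assigned_jobs_def)
  have wj: "(w, j) \<notin> mpref I m"
    using e pos by (intro worst_in_not_better[OF machine_order[OF m] w])
      (simp add: assigned_jobs_def adj_jobs_def)
  have "better_load I y j m \<le> (\<Sum>j'\<in>adj_jobs I m - {w}. y (j', m))"
    unfolding better_load_def
    by (rule sum_mono2) (use wj finite_adj_jobs unsplit_nonneg[OF u] in \<open>auto simp: adj_jobs_def\<close>)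
  also have "\<dots> = machine_total I y m - y (w, m)"
    using wadj finite_adj_jobs by (simp add: machine_total_def sum_diff1)
  also have "y (w, m) = jsize I w"
    using unsplit_value[OF u, of w m] wadj wpos by (auto simp: adj_jobs_def)
  also have "machine_total I y m - jsize I w < mcap I m"
    using y w m by (auto simp: relaxed_unsplit_def)
  finally show ?thesis .
qed

lemma held_assignment_nonneg: "P \<subseteq> edges I \<Longrightarrow> held_assignment I P e \<ge> 0"
  using held_subset jsize_pos[of "fst e" "snd e"]
  by (fastforce simp: held_assignment_def intro: less_imp_le)

lemma held_assignment_pos_iff:
  "P \<subseteq> edges I \<Longrightarrow> held_assignment I P e > 0 \<longleftrightarrow> e \<in> held I P"
  using held_subset[of P] jsize_pos[of "fst e" "snd e"]
  by (auto simp: held_assignment_def)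

lemma better_load_mono:
  "(\<And>j'. (j', j) \<in> mpref I m \<Longrightarrow> (j', m) \<in> edges I \<Longrightarrow> y (j', m) \<le> x (j', m)) \<Longrightarrow>
    better_load I y j m \<le> better_load I x j m"
  unfolding better_load_def by (rule sum_mono) (auto simp: adj_jobs_def)

lemma better_load_le_machine_total:
  "(\<And>j'. (j', m) \<in> edges I \<Longrightarrow> x (j', m) \<ge> 0) \<Longrightarrow> better_load I x j m \<le> machine_total I x m"
  unfolding better_load_def machine_total_def
  by (rule sum_mono2[OF finite_adj_jobs]) (auto simp: adj_jobs_def)

section \<open>Preservation of the invariant and optimality at the end\<close>

lemma proposal_invariant_empty: "proposal_invariant I {}"
  by (auto simp: proposal_invariant_def held_def)

lemma proposal_invariant_insert:
  assumes inv: "proposal_invariant I P" and e: "(j, m) \<in> edges I" "(j, m) \<notin> P"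
    and better: "\<And>j'. (j', j) \<in> mpref I m \<Longrightarrow> (j', m) \<in> P"
    and load: "machine_total I (held_assignment I P) m < mcap I m"
  shows "proposal_invariant I (insert (j, m) P)"
proof -
  let ?Q = "insert (j, m) P"
  have P: "P \<subseteq> edges I" and Q: "?Q \<subseteq> edges I"
    and up: "\<And>j m j'. (j, m) \<in> P \<Longrightarrow> (j', j) \<in> mpref I m \<Longrightarrow> (j', m) \<in> P"
    and bl: "\<And>j m. (j, m) \<in> held I P \<Longrightarrow> better_load I (held_assignment I P) j m < mcap I m"
    and rej: "\<And>y e. relaxed_unsplit_stable I y \<Longrightarrow> e \<in> P - held I P \<Longrightarrow> y e = 0"
    using inv e by (auto simp: proposal_invariant_def)
  have m: "m \<in> machines I" using e edges_subset by blast
  have upQ: "(j2, m1) \<in> ?Q" if "(j1, m1) \<in> ?Q" "(j2, j1) \<in> mpref I m1" for j1 m1 j2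
    using that up better by auto
  \<comment> \<open>The load of jobs preferred to \<open>j\<close> is at most the total load of
    \<open>m\<close> before the proposal, which is below capacity. For an older held edge, all
    better edges were proposed earlier, so none of them is new and the holdings among them can only
    shrink.\<close>
  have blQ: "better_load I (held_assignment I ?Q) j1 m1 < mcap I m1" if h: "(j1, m1) \<in> held I ?Q" for j1 m1
  proof (cases "(j1, m1) = (j, m)")
    case True
    have "better_load I (held_assignment I ?Q) j m \<le> better_load I (held_assignment I P) j m"
    proof (rule better_load_mono)
      fix j' assume "(j', j) \<in> mpref I m"
      then have "j' \<noteq> j" using strict_preference_on_irrefl[OF machine_order[OF m]] by blast
      then show "held_assignment I ?Q (j', m) \<le> held_assignment I P (j', m)"
        by (simp add: held_assignment_def held_insert_other)
    qed
    also have "\<dots> \<le> machine_total I (held_assignment I P) m"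
      by (rule better_load_le_machine_total) (simp add: held_assignment_nonneg P)
    finally show ?thesis using load True by simp
  next
    case False
    then have h': "(j1, m1) \<in> held I P" using h held_insert_subset by blast
    have "better_load I (held_assignment I ?Q) j1 m1 \<le> better_load I (held_assignment I P) j1 m1"
    proof (rule better_load_mono)
      fix j' assume b: "(j', j1) \<in> mpref I m1"
      have "(j', m1) \<in> P" using h' held_subset up[OF _ b] by blast
      then have "(j', m1) \<noteq> (j, m)" using e by auto
      then have "(j', m1) \<in> held I ?Q \<longrightarrow> (j', m1) \<in> held I P"
        using held_insert_subset by blast
      then show "held_assignment I ?Q (j', m1) \<le> held_assignment I P (j', m1)"
        using held_assignment_nonneg[OF P, of "(j', m1)"] by (auto simp: held_assignment_def)
    qed
    then show ?thesis using bl[OF h'] by simp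
  qed
  have rejQ: "y (j1, m1) = 0"
    if y: "relaxed_unsplit_stable I y" and r: "(j1, m1) \<in> ?Q - held I ?Q" for y j1 m1
  proof (rule ccontr)
    assume ny: "y (j1, m1) \<noteq> 0"
    have u: "unsplit I y" using y by (simp add: relaxed_unsplit_stable_def relaxed_unsplit_def)
    have e1: "(j1, m1) \<in> edges I" using r Q by blast
    then have y1: "y (j1, m1) > 0" using ny unsplit_nonneg[OF u] by force
    \<comment> \<open>Only the holding of \<open>j\<close> can change; a rejection by any other job
      is an old one, already excluded by \<open>rej\<close>.\<close>
    have j1: "j1 = j" using rej[OF y] ny r held_insert_other by (metis DiffD1 DiffD2 DiffI insertE prod.inject)
    \<comment> \<open>Taking \<open>m2\<close> as whatever \<open>j\<close> holds afterwards covers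
      both cases: the new proposal displaces an old one, or is itself rejected.\<close>
    obtain m2 where m2: "(j1, m2) \<in> held I ?Q" "m2 = m1 \<or> (m2, m1) \<in> jpref I j1"
      using held_exists[OF Q] r by blast
    then have pref: "(m2, m1) \<in> jpref I j1" using r by auto
    have e2: "(j1, m2) \<in> edges I" using m2 held_subset Q by blast
    have ord: "strict_preference_on (adj_machines I j1) (jpref I j1)"
      using job_order edges_subset e1 by blast
    have "y (j1, m2) = 0"
      using unsplit_unique[OF u e1 e2 y1] unsplit_nonneg[OF u e2] pref
        strict_preference_on_irrefl[OF ord] by (metis order_le_less)
    \<comment> \<open>Stability of \<open>y\<close> at the empty edge to \<open>m2\<close>. The
      first alternative fails because \<open>y\<close> assigns \<open>j1\<close> to
      \<open>m1\<close> only, which is worse than \<open>m2\<close>.\<close>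
    then consider m' where "m' \<in> adj_machines I j1" "y (j1, m') > 0" "(m', m2) \<in> jpref I j1"
      | "mcap I m2 \<le> better_load I y j1 m2"
      using y e2 unfolding relaxed_unsplit_stable_def better_load_def by fast
    then show False
    proof cases
      case 1
      then have "m' = m1" using unsplit_unique[OF u e1 _ y1] by (simp add: adj_machines_def)
      then show False using 1 pref strict_preference_on_asym[OF ord] by blast
    next
      case 2
      have mm2: "m2 \<in> machines I" using e2 edges_subset by blast
      \<comment> \<open>All jobs that \<open>m2\<close> prefers to \<open>j1\<close> have received
        its proposal. Those used by \<open>y\<close> cannot have rejected it, so they still hold it,
        and the held load dominates that of \<open>y\<close>. This contradicts
        \<open>blQ\<close>.\<close>
      have "better_load I y j1 m2 \<le> better_load I (held_assignment I ?Q) j1 m2"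
      proof (rule better_load_mono)
        fix j' assume b: "(j', j1) \<in> mpref I m2" and e': "(j', m2) \<in> edges I"
        have ne: "j' \<noteq> j" using b j1 strict_preference_on_irrefl[OF machine_order[OF mm2]] by blast
        have "(j', m2) \<in> ?Q" using upQ[OF _ b] m2 held_subset by blast
        then have "(j', m2) \<in> P" using ne by simp
        then have "y (j', m2) = 0 \<or> (j', m2) \<in> held I ?Q"
          using rej[OF y] held_insert_other[OF ne] by blast
        then show "y (j', m2) \<le> held_assignment I ?Q (j', m2)"
          using unsplit_value[OF u e'] held_assignment_nonneg[OF Q, of "(j', m2)"] jsize_pos[OF e']
          by (auto simp: held_assignment_def)
      qed
      then show False using 2 blQ[OF m2(1)] by simp
    qed
  qed
  show ?thesis
    unfolding proposal_invariant_def
  proof (intro conjI allI impI)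
    show "\<forall>(j1, m1)\<in>held I ?Q. better_load I (held_assignment I ?Q) j1 m1 < mcap I m1"
      using blQ by blast
    show "y e = 0" if "relaxed_unsplit_stable I y \<and> e \<in> ?Q - held I ?Q" for y e
      using that rejQ by (cases e) blast
    show "(j2, m1) \<in> ?Q" if "(j1, m1) \<in> ?Q \<and> (j2, j1) \<in> mpref I m1" for j1 m1 j2
      using that upQ by blast
  qed (fact Q)
qed

text \<open>The assumption \<open>fin\<close> says that no machine can continue: each is saturated
  or has proposed along all its edges.\<close>

lemma machine_optimal_held_assignment:
  assumes inv: "proposal_invariant I P"
    and fin: "\<And>m. m \<in> machines I \<Longrightarrow> machine_total I (held_assignment I P) m < mcap I m \<Longrightarrow>
      {e \<in> edges I. snd e = m} \<subseteq> P"
  shows "machine_optimal I (held_assignment I P)"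
proof -
  let ?x = "held_assignment I P"
  have P: "P \<subseteq> edges I" 
    and up: "\<And>j m j'. (j, m) \<in> P \<Longrightarrow> (j', j) \<in> mpref I m \<Longrightarrow> (j', m) \<in> P"
    and bl: "\<And>j m. (j, m) \<in> held I P \<Longrightarrow> better_load I ?x j m < mcap I m"
    and rej: "\<And>y e. relaxed_unsplit_stable I y \<Longrightarrow> e \<in> P - held I P \<Longrightarrow> y e = 0"
    using inv unfolding proposal_invariant_def by blast+
  \<comment> \<open>Proposals form a prefix, so neither \<open>j\<close> nor any job that
    \<open>m\<close> likes less has received one. The entire load of the saturated machine
    \<open>m\<close> thus comes from jobs preferred to \<open>j\<close>.\<close>
  have unproposed: "mcap I m \<le> better_load I ?x j m" 
    if e: "(j, m) \<in> edges I" and n: "(j, m) \<notin> P" for j m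
  proof -
    have m: "m \<in> machines I" using e edges_subset by blast
    have "mcap I m \<le> machine_total I ?x m" using fin[OF m] e n by force
    also have "\<dots> = better_load I ?x j m"
      unfolding machine_total_def better_load_def
    proof (rule sum.mono_neutral_right[OF finite_adj_jobs])
      show "\<forall>i\<in>adj_jobs I m - {j' \<in> adj_jobs I m. (j', j) \<in> mpref I m}. ?x (i, m) = 0"
      proof
        fix i assume i: "i \<in> adj_jobs I m - {j' \<in> adj_jobs I m. (j', j) \<in> mpref I m}"
        then have "i = j \<or> (j, i) \<in> mpref I m"
          using strict_preference_on_total[OF machine_order[OF m], of i j] e
          by (auto simp: adj_jobs_def)
        then have "(i, m) \<notin> P" using n up by blast
        then show "?x (i, m) = 0" using held_subset by (auto simp: held_assignment_def)
      qed
    qed auto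
    finally show ?thesis .
  qed
  have "job_total I ?x j \<le> jsize I j" if j: "j \<in> jobs I" for j
  proof (cases "\<exists>m. (j, m) \<in> held I P")
    case True
    then obtain m where m: "(j, m) \<in> held I P" ..
    then have "(j, m') \<in> held I P \<longleftrightarrow> m' = m" for m'
      using held_unique[OF P m] by blast
    then have "?x (j, m') = (if m' = m then jsize I j else 0)" for m'
      by (simp add: held_assignment_def)
    moreover have "m \<in> adj_machines I j" using m held_subset P by (auto simp: adj_machines_def)
    ultimately show ?thesis using finite_adj_machines by (simp add: job_total_def)
  next
    case False
    then have "job_total I ?x j = 0" by (simp add: job_total_def held_assignment_def)
    then show ?thesis using valid j by (simp add: valid_problem_def less_imp_le)
  qed
  then have u: "unsplit I ?x"
    using held_assignment_nonneg[OF P] by (auto simp: unsplit_def assignment_def held_assignment_def)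
  \<comment> \<open>Without its worst job \<open>w\<close>, the load of \<open>m\<close> is exactly
    the load of the jobs preferred to \<open>w\<close>, which the third clause of the invariant
    bounds.\<close>
  have "machine_total I ?x m - jsize I w < mcap I m"
    if m: "m \<in> machines I" and w: "worst_in (mpref I m) (assigned_jobs I ?x m) w" for m w
  proof -
    have h: "(w, m) \<in> held I P" and wadj: "w \<in> adj_jobs I m"
      using w held_assignment_pos_iff[OF P] by (auto simp: worst_in_def assigned_jobs_def)
    have "machine_total I ?x m - ?x (w, m) = (\<Sum>j'\<in>adj_jobs I m - {w}. ?x (j', m))"
      using wadj finite_adj_jobs by (simp add: machine_total_def sum_diff1)
    also have "\<dots> = better_load I ?x w m"
      unfolding better_load_def
    proof (rule sum.mono_neutral_right)
      show "{j' \<in> adj_jobs I m. (j', w) \<in> mpref I m} \<subseteq> adj_jobs I m - {w}"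
        using strict_preference_on_irrefl[OF machine_order[OF m]] by auto
      show "\<forall>i\<in>adj_jobs I m - {w} - {j' \<in> adj_jobs I m. (j', w) \<in> mpref I m}. ?x (i, m) = 0"
        using w held_assignment_nonneg[OF P]
        by (auto simp: worst_in_def assigned_jobs_def) (metis order_le_less)
    qed (simp add: finite_adj_jobs)
    also have "\<dots> < mcap I m" using bl[OF h] .
    finally show ?thesis using h by (simp add: held_assignment_def)
  qed
  then have rel: "relaxed_unsplit I ?x" using u by (auto simp: relaxed_unsplit_def)
  \<comment> \<open>An edge with value 0 was either rejected, and its job holds something better, or
    never proposed, and \<open>unproposed\<close> applies.\<close>
  have "(\<exists>m'\<in>adj_machines I j. ?x (j, m') > 0 \<and> (m', m) \<in> jpref I j) \<or> mcap I m \<le> better_load I ?x j m"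
    if e: "(j, m) \<in> edges I" and z: "?x (j, m) = 0" for j m
  proof (cases "(j, m) \<in> P")
    case True
    have "(j, m) \<notin> held I P" using z held_assignment_pos_iff[OF P, of "(j, m)"] by simp
    moreover obtain m' where "(j, m') \<in> held I P" "m' = m \<or> (m', m) \<in> jpref I j"
      using held_exists[OF P True] .
    ultimately show ?thesis
      using P held_subset held_assignment_pos_iff[OF P] by (fastforce simp: adj_machines_def)
  next
    case False
    then show ?thesis using unproposed[OF e] by simp
  qed
  then have stable: "relaxed_unsplit_stable I ?x"
    using rel by (auto simp: relaxed_unsplit_stable_def better_load_def)
  moreover have "weakly_prefers I m ?x y"
    if m: "m \<in> machines I" and y: "relaxed_unsplit_stable I y" for m y
  proof -
    define D where "D = {j \<in> adj_jobs I m. (?x (j, m) > 0) \<noteq> (y (j, m) > 0)}"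
    have ry: "relaxed_unsplit I y" and uy: "unsplit I y"
      using y by (auto simp: relaxed_unsplit_stable_def relaxed_unsplit_def)
    have "\<exists>j. best_in (mpref I m) D j \<and> ?x (j, m) > 0" if ne: "D \<noteq> {}"
    proof -
      have "D \<subseteq> adj_jobs I m" by (auto simp: D_def)
      then obtain j where j: "best_in (mpref I m) D j"
        using best_in_exists[OF machine_order[OF m] _ ne] finite_subset finite_adj_jobs by metis
      \<comment> \<open>If only \<open>y\<close> used the best differing job \<open>j\<close>, the
        edge would never have been proposed: it is not held, and \<open>rej\<close> forbids its
        rejection. So \<open>m\<close> is filled by jobs preferred to \<open>j\<close>, on which
        both assignments agree; then \<open>y\<close> overfills \<open>m\<close> even in the relaxed
        sense.\<close>
      have "?x (j, m) > 0"
      proof (rule ccontr)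
        assume n: "\<not> ?x (j, m) > 0"
        then have yj: "y (j, m) > 0" and e: "(j, m) \<in> edges I"
          using j by (auto simp: best_in_def D_def adj_jobs_def)
        have "(j, m) \<notin> held I P" using n held_assignment_pos_iff[OF P] by blast
        then have "(j, m) \<notin> P" using rej[OF y] yj by force
        then have "mcap I m \<le> better_load I ?x j m" using unproposed[OF e] by blast
        also have "\<dots> \<le> better_load I y j m"
        proof (rule better_load_mono)
          fix j' assume b: "(j', j) \<in> mpref I m" and e': "(j', m) \<in> edges I"
          have "j' \<notin> D"
            using b best_in_not_better[OF machine_order[OF m] j] by blast
          then have "?x (j', m) > 0 \<longleftrightarrow> y (j', m) > 0"
            using e' by (simp add: D_def adj_jobs_def)
          then show "?x (j', m) \<le> y (j', m)"
            using unsplit_value[OF uy e'] unsplit_value[OF u e'] unsplit_nonneg[OF uy e'] jsize_pos[OF e']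
            by fastforce
        qed
        finally show False using relaxed_unsplit_better_load[OF ry e yj] by simp
      qed
      then show ?thesis using j by blast
    qed
    then show ?thesis unfolding weakly_prefers_def Let_def D_def[symmetric] by blast
  qed
  ultimately show ?thesis by (simp add: machine_optimal_def)
qed

text \<open>A maximal set satisfying the invariant is final: otherwise an unsaturated machine could
  add its best unproposed edge.\<close>

lemma machine_optimal_exists: "\<exists>x. machine_optimal I x"
proof -
  let ?S = "{P. proposal_invariant I P}"
  have "?S \<subseteq> Pow (edges I)" by (auto simp: proposal_invariant_def)
  then have "finite ?S" using finite_edges finite_subset by blast
  moreover have "?S \<noteq> {}" using proposal_invariant_empty by blast
  ultimately obtain P where P: "proposal_invariant I P"
    and max: "\<And>Q. proposal_invariant I Q \<Longrightarrow> P \<subseteq> Q \<Longrightarrow> Q = P"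
    using finite_has_maximal[of ?S] by (metis mem_Collect_eq)
  have "machine_optimal I (held_assignment I P)"
  proof (rule machine_optimal_held_assignment[OF P], rule ccontr)
    fix m
    assume m: "m \<in> machines I" and l: "machine_total I (held_assignment I P) m < mcap I m"
      and n: "\<not> {e \<in> edges I. snd e = m} \<subseteq> P"
    let ?U = "{j. (j, m) \<in> edges I - P}"
    have "?U \<subseteq> adj_jobs I m" "?U \<noteq> {}" using n by (auto simp: adj_jobs_def)
    then obtain j where j: "best_in (mpref I m) ?U j"
      using best_in_exists[OF machine_order[OF m]] finite_subset[OF _ finite_adj_jobs] by metis
    have "proposal_invariant I (insert (j, m) P)"
    proof (rule proposal_invariant_insert[OF P])
      show "(j, m) \<in> edges I" "(j, m) \<notin> P" using j by (auto simp: best_in_def)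
      show "(j', m) \<in> P" if "(j', j) \<in> mpref I m" for j'
        using that mpref_edge[OF m that] best_in_not_better[OF machine_order[OF m] j] by blast
    qed (fact l)
    then have "insert (j, m) P = P" using max by blast
    then show False using j by (auto simp: best_in_def)
  qed
  then show ?thesis by blast
qed

section \<open>Effect of one proposal: the job is free, improves, or refuses\<close>

lemma held_insert_new:
  assumes "(j, m) \<in> edges I" "\<And>m'. (j, m') \<notin> P"
  shows "held I (insert (j, m) P) = insert (j, m) (held I P)"
  using assms strict_preference_on_irrefl[OF job_order, of j m] edges_subset
  by (auto simp: held_def)

text \<open>By transitivity, any proposal beating \<open>m\<close> would also beat
  \<open>m'\<close>, which was the best one so far.\<close>

lemma held_insert_better:
  assumes P: "P \<subseteq> edges I" and h: "(j, m') \<in> held I P" and b: "(m, m') \<in> jpref I j"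
  shows "held I (insert (j, m) P) = insert (j, m) (held I P - {(j, m')})"
proof -
  have ord: "strict_preference_on (adj_machines I j) (jpref I j)"
    using job_order edges_subset h P held_subset by blast
  have top: "(j, m) \<in> held I (insert (j, m) P)"
    using h strict_preference_on_irrefl[OF ord] strict_preference_on_trans[OF ord _ b]
    by (auto simp: held_def)
  have "(j, m') \<notin> held I (insert (j, m) P)" using b by (auto simp: held_def)
  moreover have "e \<in> held I (insert (j, m) P)" if "e \<in> held I P" "e \<noteq> (j, m')" for e
    using that held_unique[OF P h] held_insert_other[of "fst e" j "snd e" m P] by (cases e) auto
  ultimately show ?thesis using top held_insert_subset[of j m P] by blast
qed

lemma held_insert_worse:
  assumes P: "P \<subseteq> edges I" and h: "(j, m') \<in> held I P" and b: "(m', m) \<in> jpref I j"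
  shows "held I (insert (j, m) P) = held I P"
proof -
  have ord: "strict_preference_on (adj_machines I j) (jpref I j)"
    using job_order edges_subset h P held_subset by blast
  have "(j, m') \<in> P" using h held_subset by blast
  then have "(j, m) \<notin> held I (insert (j, m) P)" using b by (auto simp: held_def)
  moreover have "(j, m') \<in> held I (insert (j, m) P)"
    using h b strict_preference_on_asym[OF ord] by (auto simp: held_def)
  then have "e \<in> held I (insert (j, m) P)" if "e \<in> held I P" for e
    using that held_unique[OF P h] held_insert_other[of "fst e" j "snd e" m P] by (cases e) auto
  ultimately show ?thesis using held_insert_subset[of j m P] by blast
qed

text \<open>It justifies maintaining loads by one addition or subtraction per changed edge.\<close>

lemma machine_total_upd:
  assumes "(j, m) \<in> edges I"
  shows "machine_total I (x((j, m) := v)) m' =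
    machine_total I x m' + (if m' = m then v - x (j, m) else 0)"
proof (cases "m' = m")
  case True
  have j: "j \<in> adj_jobs I m" using assms by (simp add: adj_jobs_def)
  have "(\<Sum>i\<in>adj_jobs I m. (x((j, m) := v)) (i, m)) = v + (\<Sum>i\<in>adj_jobs I m - {j}. x (i, m))"
    using sum.remove[OF finite_adj_jobs j, of "\<lambda>i. (x((j, m) := v)) (i, m)"] by simp
  moreover have "(\<Sum>i\<in>adj_jobs I m. x (i, m)) = x (j, m) + (\<Sum>i\<in>adj_jobs I m - {j}. x (i, m))"
    using sum.remove[OF finite_adj_jobs j] by simp
  ultimately show ?thesis using True by (simp add: machine_total_def)
qed (simp add: machine_total_def)

lemma held_assignment_insert_new:
  assumes "(j, m) \<in> edges I" "\<And>m'. (j, m') \<notin> P"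
  shows "held_assignment I (insert (j, m) P) = (held_assignment I P)((j, m) := jsize I j)"
  using held_insert_new[OF assms] by (auto simp: held_assignment_def)

lemma held_assignment_insert_better:
  assumes "P \<subseteq> edges I" "(j, m') \<in> held I P" "(m, m') \<in> jpref I j"
  shows "held_assignment I (insert (j, m) P) =
    (held_assignment I P)((j, m') := 0, (j, m) := jsize I j)"
  using held_insert_better[OF assms] by (auto simp: held_assignment_def)

lemma held_assignment_insert_worse:
  assumes "P \<subseteq> edges I" "(j, m') \<in> held I P" "(m', m) \<in> jpref I j"
  shows "held_assignment I (insert (j, m) P) = held_assignment I P"
  using held_insert_worse[OF assms] by (auto simp: held_assignment_def)

end

section \<open>Loop-free programs and loops with a variant\<close>

primrec loop_free :: "com \<Rightarrow> bool" where
  "loop_free Skip \<longleftrightarrow> True"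
| "loop_free (NStore a i e) \<longleftrightarrow> True"
| "loop_free (RStore a i e) \<longleftrightarrow> True"
| "loop_free (Seq c d) \<longleftrightarrow> loop_free c \<and> loop_free d"
| "loop_free (Cond b c d) \<longleftrightarrow> loop_free c \<and> loop_free d"
| "loop_free (While b c) \<longleftrightarrow> False"

text \<open>Functional semantics of loop bodies, so that their effect can be computed by
  simplification. The value at \<open>While\<close> is a placeholder.\<close>

primrec run :: "com \<Rightarrow> mem \<Rightarrow> mem" where
  "run Skip s = s"
| "run (NStore a i e) s = nupd a (nval i s) (nval e s) s"
| "run (RStore a i e) s = rupd a (nval i s) (rval e s) s"
| "run (Seq c d) s = run d (run c s)"
| "run (Cond b c d) s = (if bval b s then run c s else run d s)"
| "run (While b c) s = s"

text \<open>Both branches of a conditional are charged, which makes the bound independent of the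
  memory: every loop body costs a constant.\<close>

primrec time_bound :: "com \<Rightarrow> nat" where
  "time_bound Skip = 1"
| "time_bound (NStore a i e) = ncost i + ncost e + 1"
| "time_bound (RStore a i e) = ncost i + rcost e + 1"
| "time_bound (Seq c d) = time_bound c + time_bound d"
| "time_bound (Cond b c d) = bcost b + (time_bound c + time_bound d) + 1"
| "time_bound (While b c) = 0"

lemma exec_run: "loop_free c \<Longrightarrow> \<exists>t\<le>time_bound c. exec c s t (run c s)"
proof (induction c arbitrary: s)
  case Skip
  show ?case using exec_Skip[of s] by auto
next
  case (NStore a i e)
  show ?case using exec_NStore[of a i e s] by auto
next
  case (RStore a i e)
  show ?case using exec_RStore[of a i e s] by auto
next
  case (Seq c d)
  then obtain t u where "t \<le> time_bound c" "exec c s t (run c s)"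
    "u \<le> time_bound d" "exec d (run c s) u (run d (run c s))"
    by (metis loop_free.simps(4))
  then show ?case using exec_Seq by (metis add_mono run.simps(4) time_bound.simps(4))
next
  case (Cond b c d)
  show ?case
  proof (cases "bval b s")
    case True
    obtain t where "t \<le> time_bound c" "exec c s t (run c s)" using Cond by auto
    then show ?thesis using exec_CondT[OF True, of c t "run c s" d] True
      by (intro exI[of _ "bcost b + t + 1"]) auto
  next
    case False
    obtain t where "t \<le> time_bound d" "exec d s t (run d s)" using Cond by auto
    then show ?thesis using exec_CondF[OF False, of d t "run d s" c] False
      by (intro exI[of _ "bcost b + t + 1"]) auto
  qed
qed simp

text \<open>The invariant carries the variant as its first argument. At most \<open>n\<close>
  iterations happen; the extra 1 in \<open>n + 1\<close> pays for the failing test at the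
  end.\<close>

lemma exec_While:
  assumes lf: "loop_free c"
    and step: "\<And>n s. Inv n s \<Longrightarrow> bval b s \<Longrightarrow> \<exists>n'<n. Inv n' (run c s)"
    and init: "Inv n s"
  shows "\<exists>t s' n'. exec (While b c) s t s' \<and> Inv n' s' \<and> \<not> bval b s' \<and>
    t \<le> (n + 1) * (bcost b + time_bound c + 1)"
  using init
proof (induction n arbitrary: s rule: less_induct)
  case (less n)
  let ?K = "bcost b + time_bound c + 1"
  show ?case
  proof (cases "bval b s")
    case True
    obtain n1 where n1: "n1 < n" "Inv n1 (run c s)" using step[OF less.prems True] by blast
    obtain t where t: "t \<le> time_bound c" "exec c s t (run c s)" using exec_run[OF lf] by blast
    obtain u s' n' where u: "exec (While b c) (run c s) u s'" "Inv n' s'" "\<not> bval b s'"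
      "u \<le> (n1 + 1) * ?K" using less.IH[OF n1] by blast
    have "(n1 + 1) * ?K \<le> n * ?K" using n1(1) by (intro mult_right_mono) auto
    then have "bcost b + t + u + 1 \<le> (n + 1) * ?K" using u(4) t(1) by simp
    then show ?thesis using exec_WhileT[OF True t(2) u(1)] u(2,3) by blast
  next
    case False
    then show ?thesis using exec_WhileF[OF False, of c] less.prems
      by (intro exI[of _ "bcost b + 1"] exI[of _ s] exI[of _ n]) simp
  qed
qed

section \<open>Reading memory after a store\<close>

lemma nmem_nupd [simp]: "nmem (nupd a i v s) b = (if b = a then (nmem s a)(i := v) else nmem s b)"
  by (simp add: nupd_def)

lemma rmem_nupd [simp]: "rmem (nupd a i v s) = rmem s"
  by (simp add: nupd_def)

lemma nmem_rupd [simp]: "nmem (rupd a i v s) = nmem s"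
  by (simp add: rupd_def)

lemma rmem_rupd [simp]: "rmem (rupd a i v s) b = (if b = a then (rmem s a)(i := v) else rmem s b)"
  by (simp add: rupd_def)

section \<open>The algorithm on represented instances\<close>

locale incidence =
  fixes nv ne :: nat and endpoint :: "nat \<Rightarrow> nat" and better :: "nat \<Rightarrow> nat \<Rightarrow> nat \<Rightarrow> bool"
    and off lst :: "nat \<Rightarrow> nat"
  assumes incidence: "incidence_lists nv ne endpoint better off lst"
    and endpoint: "e < ne \<Longrightarrow> endpoint e < nv"
    and better_irrefl: "i < nv \<Longrightarrow> \<not> better i e e"
begin

lemma off_0: "off 0 = 0"
  using incidence by (simp add: incidence_lists_def)

lemma off_Suc: "i < nv \<Longrightarrow> off i \<le> off (Suc i)"
  using incidence by (simp add: incidence_lists_def)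

lemma set_lst: "i < nv \<Longrightarrow> lst ` {off i..<off (Suc i)} = {e. e < ne \<and> endpoint e = i}"
  using incidence by (simp add: incidence_lists_def Let_def)

lemma lst_better:
  assumes "i < nv" "off i \<le> p" "p < q" "q < off (Suc i)"
  shows "better i (lst p) (lst q)"
proof -
  let ?es = "map lst [off i..<off (Suc i)]"
  have "sorted_wrt (better i) ?es"
    using incidence assms(1) by (simp add: incidence_lists_def Let_def)
  then have "better i (?es ! (p - off i)) (?es ! (q - off i))"
    by (rule sorted_wrt_nth_less) (use assms in auto)
  then show ?thesis using assms by simp
qed

lemma lst_bounds: "i < nv \<Longrightarrow> off i \<le> p \<Longrightarrow> p < off (Suc i) \<Longrightarrow> lst p < ne \<and> endpoint (lst p) = i"
  using set_lst[of i] imageI[of p "{off i..<off (Suc i)}" lst] by auto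

lemma lst_position:
  assumes "e < ne"
  obtains p where "off (endpoint e) \<le> p" "p < off (Suc (endpoint e))" "lst p = e"
proof -
  have "e \<in> lst ` {off (endpoint e)..<off (Suc (endpoint e))}"
    using set_lst[OF endpoint[OF assms]] assms by simp
  then show thesis using that by auto
qed

text \<open>A list sorted by an irreflexive relation has no repetitions, so its length is the degree
  of its vertex, and offsets are partial sums of degrees. This confines all lists to the first
  \<open>ne\<close> cells.\<close>

lemma off_eq_card: "k \<le> nv \<Longrightarrow> off k = card {e. e < ne \<and> endpoint e < k}"
proof (induction k)
  case 0
  then show ?case by (simp add: off_0)
next
  case (Suc k)
  then have k: "k < nv" by simp
  have "inj_on lst {off k..<off (Suc k)}"
  proof (rule linorder_inj_onI)
    fix p q assume "p < q" "p \<in> {off k..<off (Suc k)}" "q \<in> {off k..<off (Suc k)}"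
    then show "lst p \<noteq> lst q"
      using lst_better[OF k, of p q] better_irrefl[OF k] by force
  qed auto
  then have "off (Suc k) - off k = card {e. e < ne \<and> endpoint e = k}"
    using set_lst[OF k] card_image by fastforce
  moreover have "{e. e < ne \<and> endpoint e < Suc k} =
      {e. e < ne \<and> endpoint e < k} \<union> {e. e < ne \<and> endpoint e = k}" by auto
  then have "card {e. e < ne \<and> endpoint e < Suc k} =
      card {e. e < ne \<and> endpoint e < k} + card {e. e < ne \<and> endpoint e = k}"
    by (simp only:) (rule card_Un_disjoint, auto)
  ultimately show ?case using Suc off_Suc[OF k] by simp
qed

lemma off_le: "k \<le> nv \<Longrightarrow> off k \<le> ne"
  using off_eq_card[of k] card_mono[of "{..<ne}" "{e. e < ne \<and> endpoint e < k}"] by auto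

text \<open>Every edge number occurs in the first \<open>ne\<close> cells, so by counting none
  occurs there twice.\<close>

lemma inj_on_lst: "inj_on lst {..<ne}"
proof (rule eq_card_imp_inj_on)
  have "{..<ne} \<subseteq> lst ` {..<ne}"
  proof
    fix e assume "e \<in> {..<ne}"
    then have e: "e < ne" by simp
    from lst_position[OF e] obtain p where p: "p < off (Suc (endpoint e))" "lst p = e" by blast
    have "off (Suc (endpoint e)) \<le> ne" using off_le endpoint[OF e] by simp
    then show "e \<in> lst ` {..<ne}" using p by force
  qed
  then have "ne \<le> card (lst ` {..<ne})" using card_mono[of "lst ` {..<ne}" "{..<ne}"] by simp
  moreover have "card (lst ` {..<ne}) \<le> ne" using card_image_le[of "{..<ne}" lst] by simp
  ultimately show "card (lst ` {..<ne}) = card {..<ne}" by simp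
qed simp

lemma lst_position_less:
  assumes "e < ne"
  obtains p where "p < ne" "off (endpoint e) \<le> p" "p < off (Suc (endpoint e))" "lst p = e"
  using lst_position[OF assms] off_le[of "Suc (endpoint e)"] endpoint[OF assms]
  by (metis Suc_leI order_less_le_trans)

end

section \<open>An instance given by an initial memory\<close>

locale representation = valid_instance I for I :: "('j, 'm) problem" +
  fixes jn :: "nat \<Rightarrow> 'j" and mn :: "nat \<Rightarrow> 'm" and s0 :: mem
  assumes represents: "represents I jn mn s0"
begin

abbreviation "nj \<equiv> nmem s0 0 0"
abbreviation "nm \<equiv> nmem s0 0 (Suc 0)"
abbreviation "ne \<equiv> nmem s0 0 2"
abbreviation "joff \<equiv> nmem s0 (Suc 0)"
abbreviation "jlst \<equiv> nmem s0 2"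
abbreviation "moff \<equiv> nmem s0 3"
abbreviation "mlst \<equiv> nmem s0 4"
abbreviation "job_of \<equiv> nmem s0 5"
abbreviation "mach_of \<equiv> nmem s0 6"
abbreviation "edge \<equiv> edge_at jn mn s0"

lemma bij_jn: "bij_betw jn {..<nj} (jobs I)"
  and bij_mn: "bij_betw mn {..<nm} (machines I)"
  and bij_edge: "bij_betw edge {..<ne} (edges I)"
  and end_bounds: "\<And>e. e < ne \<Longrightarrow> job_of e < nj \<and> mach_of e < nm"
  and rmem_jsize: "\<And>i. i < nj \<Longrightarrow> rmem s0 0 i = jsize I (jn i)"
  and rmem_mcap: "\<And>i. i < nm \<Longrightarrow> rmem s0 (Suc 0) i = mcap I (mn i)"
  using represents by (simp_all add: represents_def Let_def)

lemma jn_job: "i < nj \<Longrightarrow> jn i \<in> jobs I"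
  using bij_jn by (auto simp: bij_betw_def)

lemma mn_machine: "i < nm \<Longrightarrow> mn i \<in> machines I"
  using bij_mn by (auto simp: bij_betw_def)

sublocale jl: incidence nj ne job_of
  "\<lambda>i e e'. (mn (mach_of e), mn (mach_of e')) \<in> jpref I (jn i)" joff jlst
proof
  show "incidence_lists nj ne job_of
      (\<lambda>i e e'. (mn (mach_of e), mn (mach_of e')) \<in> jpref I (jn i)) joff jlst"
    using represents by (simp add: represents_def Let_def)
qed (auto simp: end_bounds dest: strict_preference_on_irrefl[OF job_order[OF jn_job]])

sublocale ml: incidence nm ne mach_of
  "\<lambda>i e e'. (jn (job_of e), jn (job_of e')) \<in> mpref I (mn i)" moff mlst
proof
  show "incidence_lists nm ne mach_of
      (\<lambda>i e e'. (jn (job_of e), jn (job_of e')) \<in> mpref I (mn i)) moff mlst"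
    using represents by (simp add: represents_def Let_def)
qed (auto simp: end_bounds dest: strict_preference_on_irrefl[OF machine_order[OF mn_machine]])

lemma card_edges: "card (edges I) = ne"
  using bij_betw_same_card[OF bij_edge] by simp

lemma edge_in: "e < ne \<Longrightarrow> edge e \<in> edges I"
  using bij_edge by (auto simp: bij_betw_def)

lemma edge_eq_iff: "e < ne \<Longrightarrow> e' < ne \<Longrightarrow> edge e = edge e' \<longleftrightarrow> e = e'"
  using bij_edge by (auto simp: bij_betw_def inj_on_def)

lemma edge_number:
  assumes "a \<in> edges I"
  obtains e where "e < ne" "edge e = a"
  using assms bij_edge unfolding bij_betw_def by (metis imageE lessThan_iff)

lemma jn_eq_iff: "e < ne \<Longrightarrow> e' < ne \<Longrightarrow> jn (job_of e) = jn (job_of e') \<longleftrightarrow> job_of e = job_of e'"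
  using bij_jn end_bounds by (auto simp: bij_betw_def inj_on_def)

lemma mn_eq_iff: "e < ne \<Longrightarrow> e' < ne \<Longrightarrow> mn (mach_of e) = mn (mach_of e') \<longleftrightarrow> mach_of e = mach_of e'"
  using bij_mn end_bounds by (auto simp: bij_betw_def inj_on_def)

text \<open>Here \<open>r\<close> inverts the array of job lists, so that a job can compare two of
  its edges in constant time.\<close>

definition ranks :: "(nat \<Rightarrow> nat) \<Rightarrow> bool" where
  "ranks r \<longleftrightarrow> (\<forall>p<ne. r (jlst p) = p)"

text \<open>Both edges lie in the list of the same job, where the order of positions is the order of
  preference.\<close>

lemma ranks_less:
  assumes r: "ranks r" and e: "e < ne" "e' < ne" "job_of e = job_of e'" and l: "r e < r e'"
  shows "(mn (mach_of e), mn (mach_of e')) \<in> jpref I (jn (job_of e))"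
proof -
  obtain p where p: "p < ne" "joff (job_of e) \<le> p" "jlst p = e"
    by (metis jl.lst_position_less[OF e(1)])
  obtain q where q: "q < ne" "q < joff (Suc (job_of e'))" "jlst q = e'"
    by (metis jl.lst_position_less[OF e(2)])
  have "p < q" using l r p q by (auto simp: ranks_def)
  then show ?thesis using jl.lst_better[of "job_of e" p q] p q e end_bounds by simp
qed

lemma ranks_inj:
  assumes "ranks r" "e < ne" "e' < ne" "r e = r e'"
  shows "e = e'"
proof -
  obtain p where p: "p < ne" "jlst p = e" by (metis jl.lst_position_less[OF assms(2)])
  obtain q where q: "q < ne" "jlst q = e'" by (metis jl.lst_position_less[OF assms(3)])
  show ?thesis using assms(1,4) p q by (auto simp: ranks_def)
qed

section \<open>Linking the working arrays to the set of proposals\<close>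

abbreviation "active \<equiv> mach_of ` {..<ne}"

text \<open>The proposals of a machine are the part of its list before its pointer. Only machines
  with edges are covered, because the cells of isolated ones are never initialised.\<close>

definition pointers_ok :: "(nat \<Rightarrow> nat) \<Rightarrow> ('j \<times> 'm) set \<Rightarrow> bool" where
  "pointers_ok ptr P \<longleftrightarrow> (\<forall>i\<in>active. moff i \<le> ptr i \<and> ptr i \<le> moff (Suc i) \<and>
     (\<forall>p. moff i \<le> p \<and> p < moff (Suc i) \<longrightarrow> (edge (mlst p) \<in> P \<longleftrightarrow> p < ptr i)))"

text \<open>Edge numbers are shifted by one, so that 0 can mark a free job. Jobs are addressed as
  end points of edges.\<close>

definition holds_ok :: "(nat \<Rightarrow> nat) \<Rightarrow> ('j \<times> 'm) set \<Rightarrow> bool" where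
  "holds_ok hold P \<longleftrightarrow> (\<forall>e<ne. hold (job_of e) = 0 \<longrightarrow> edge e \<notin> P) \<and>
     (\<forall>e'<ne. \<forall>e. hold (job_of e') = Suc e \<longrightarrow> e < ne \<and> job_of e = job_of e' \<and> edge e \<in> held I P)"

lemma holds_ok_free: "holds_ok hold P \<Longrightarrow> e < ne \<Longrightarrow> hold (job_of e) = 0 \<Longrightarrow> edge e \<notin> P"
  unfolding holds_ok_def by blast

lemma holds_ok_held:
  "holds_ok hold P \<Longrightarrow> e' < ne \<Longrightarrow> hold (job_of e') = Suc e \<Longrightarrow>
    e < ne \<and> job_of e = job_of e' \<and> edge e \<in> held I P"
  unfolding holds_ok_def by blast

lemma holds_ok_accept:
  assumes hold: "holds_ok hold P" and e: "e < ne" and held: "edge e \<in> held I (insert (edge e) P)"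
    and other: "\<And>e'. e' < ne \<Longrightarrow> job_of e' \<noteq> job_of e \<Longrightarrow> edge e' \<in> held I P \<Longrightarrow>
      edge e' \<in> held I (insert (edge e) P)"
  shows "holds_ok (hold(job_of e := Suc e)) (insert (edge e) P)"
  unfolding holds_ok_def
proof (intro conjI allI impI)
  fix e' assume e': "e' < ne" "(hold(job_of e := Suc e)) (job_of e') = 0"
  then have "job_of e' \<noteq> job_of e" by auto
  then show "edge e' \<notin> insert (edge e) P"
    using holds_ok_free[OF hold e'(1)] e' edge_eq_iff[OF e'(1) e] by auto
next
  fix e' e1 assume e': "e' < ne" "(hold(job_of e := Suc e)) (job_of e') = Suc e1"
  show "e1 < ne" "job_of e1 = job_of e'" "edge e1 \<in> held I (insert (edge e) P)"
  proof (atomize (full), cases "job_of e' = job_of e")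
    case True
    then have "e1 = e" using e' by simp
    then show "e1 < ne \<and> job_of e1 = job_of e' \<and> edge e1 \<in> held I (insert (edge e) P)"
      using True e held by simp
  next
    case False
    then have "hold (job_of e') = Suc e1" using e' by simp
    then have "e1 < ne" "job_of e1 = job_of e'" "edge e1 \<in> held I P"
      using holds_ok_held[OF hold e'(1)] by blast+
    then show "e1 < ne \<and> job_of e1 = job_of e' \<and> edge e1 \<in> held I (insert (edge e) P)"
      using other False by metis
  qed
qed

definition loads_ok :: "(nat \<Rightarrow> real) \<Rightarrow> (nat \<Rightarrow> real) \<Rightarrow> ('j \<times> 'm) set \<Rightarrow> bool" where
  "loads_ok x load P \<longleftrightarrow> (\<forall>e<ne. x e = held_assignment I P (edge e)) \<and>
     (\<forall>i\<in>active. load i = machine_total I (held_assignment I P) (mn i))"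

text \<open>Repeated, saturated or exhausted machines may lie on the stack; what matters is that
  every machine able to propose is on it.\<close>

definition stack_ok ::
  "(nat \<Rightarrow> nat) \<Rightarrow> (nat \<Rightarrow> nat) \<Rightarrow> nat \<Rightarrow> (nat \<Rightarrow> real) \<Rightarrow> bool" where
  "stack_ok ptr stack sp load \<longleftrightarrow> stack ` {..<sp} \<subseteq> active \<and>
     (\<forall>i\<in>active. load i < mcap I (mn i) \<and> ptr i < moff (Suc i) \<longrightarrow> i \<in> stack ` {..<sp})"

definition proposal_state where
  "proposal_state ptr hold stack sp x load P \<longleftrightarrow> proposal_invariant I P \<and>
     pointers_ok ptr P \<and> holds_ok hold P \<and> loads_ok x load P \<and> stack_ok ptr stack sp load"

text \<open>As the list is sorted, the edge at the pointer is the best one not yet proposed: edges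
  to better jobs stand before it and belong to \<open>P\<close>.\<close>

lemma next_proposal:
  assumes inv: "proposal_invariant I P" and ptr: "pointers_ok ptr P" and loads: "loads_ok x load P"
    and m: "m \<in> active" and load: "load m < mcap I (mn m)" and more: "ptr m < moff (Suc m)"
  shows "mlst (ptr m) < ne" "mach_of (mlst (ptr m)) = m" "edge (mlst (ptr m)) \<notin> P"
    "proposal_invariant I (insert (edge (mlst (ptr m))) P)"
    "pointers_ok (ptr(m := Suc (ptr m))) (insert (edge (mlst (ptr m))) P)"
proof -
  let ?e = "mlst (ptr m)"
  have nm: "m < nm" using m end_bounds by auto
  have low: "moff m \<le> ptr m" using ptr m by (auto simp: pointers_ok_def)
  show ne: "?e < ne" and mach: "mach_of ?e = m" using ml.lst_bounds[OF nm low more] by auto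
  show notin: "edge ?e \<notin> P"
    using ptr m low more by (auto simp: pointers_ok_def)
  have e: "edge ?e = (jn (job_of ?e), mn m)" using mach by (simp add: edge_at_def)
  have ord: "strict_preference_on (adj_jobs I (mn m)) (mpref I (mn m))"
    using machine_order mn_machine nm by blast
  have "proposal_invariant I (insert (jn (job_of ?e), mn m) P)"
  proof (rule proposal_invariant_insert[OF inv])
    show "(jn (job_of ?e), mn m) \<in> edges I" using e edge_in[OF ne] by simp
    show "(jn (job_of ?e), mn m) \<notin> P" using e notin by simp
    show "machine_total I (held_assignment I P) (mn m) < mcap I (mn m)"
      using loads m load by (auto simp: loads_ok_def)
    show "(j', mn m) \<in> P" if b: "(j', jn (job_of ?e)) \<in> mpref I (mn m)" for j'
    proof -
      have "(j', mn m) \<in> edges I" using mpref_edge[OF mn_machine[OF nm] b] .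
      then obtain e' where e': "e' < ne" "edge e' = (j', mn m)" by (rule edge_number)
      then have j': "j' = jn (job_of e')" and "mn (mach_of e') = mn (mach_of ?e)"
        using mach by (auto simp: edge_at_def)
      then have m': "mach_of e' = m" using mn_eq_iff e' ne mach by metis
      obtain p where p: "moff m \<le> p" "p < moff (Suc m)" "mlst p = e'"
        using ml.lst_position[OF e'(1)] m' by metis
      have "\<not> ptr m < p"
        using ml.lst_better[OF nm low _ p(2)] p(3) b j' strict_preference_on_asym[OF ord] by blast
      moreover have "p \<noteq> ptr m"
        using p(3) b j' strict_preference_on_irrefl[OF ord] by blast
      ultimately have "p < ptr m" by simp
      then have "edge (mlst p) \<in> P" using ptr m p(1,2) unfolding pointers_ok_def by blast
      then show ?thesis using p(3) e'(2) by simp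
    qed
  qed
  then show "proposal_invariant I (insert (edge ?e) P)" using e by simp
  have "edge (mlst p) \<in> insert (edge ?e) P \<longleftrightarrow> p < (ptr(m := Suc (ptr m))) i"
    if i: "i \<in> active" and p: "moff i \<le> p" "p < moff (Suc i)" for i p
  proof -
    have ni: "i < nm" using i end_bounds by auto
    have b: "mlst p < ne" "mach_of (mlst p) = i" using ml.lst_bounds[OF ni p] by auto
    have old: "edge (mlst p) \<in> P \<longleftrightarrow> p < ptr i" using ptr i p by (auto simp: pointers_ok_def)
    \<comment> \<open>Since \<open>mlst\<close> is injective on the first \<open>ne\<close> cells,
      the new edge stands at a single position, so only the pointer of \<open>m\<close> must
      move.\<close>
    have "p < ne" "ptr m < ne"
      using p(2) more ml.off_le[of "Suc i"] ml.off_le[of "Suc m"] ni nm by auto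
    then have "edge (mlst p) = edge ?e \<longleftrightarrow> p = ptr m"
      using edge_eq_iff[OF b(1) ne] ml.inj_on_lst by (auto simp: inj_on_def)
    moreover have "i = m" if "p = ptr m" using that b mach by simp
    ultimately show ?thesis using old by auto
  qed
  then show "pointers_ok (ptr(m := Suc (ptr m))) (insert (edge ?e) P)"
    using ptr more unfolding pointers_ok_def by (auto simp: le_Suc_eq)
qed

lemma hold_no_proposal:
  assumes inv: "proposal_invariant I P" and hold: "holds_ok hold P"
    and e: "e < ne" "hold (job_of e) = 0"
  shows "(jn (job_of e), m') \<notin> P"
proof
  assume a: "(jn (job_of e), m') \<in> P"
  then have "(jn (job_of e), m') \<in> edges I" using inv by (auto simp: proposal_invariant_def)
  then obtain e' where e': "e' < ne" "edge e' = (jn (job_of e), m')" by (rule edge_number)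
  then have "job_of e' = job_of e" using jn_eq_iff e by (auto simp: edge_at_def)
  then show False using holds_ok_free[OF hold e'(1)] e e' a by simp
qed

text \<open>The proposing machine stays on the stack, so \<open>stack_ok\<close> does not depend on
  its new load and pointer.\<close>

lemma proposal_state_new:
  assumes st: "proposal_state ptr hold stack sp x load P"
    and m: "m \<in> stack ` {..<sp}" and load: "load m < mcap I (mn m)" and more: "ptr m < moff (Suc m)"
    and e: "e = mlst (ptr m)" and free: "hold (job_of e) = 0"
    and q: "q = jsize I (jn (job_of e))"
  shows "proposal_state (ptr(m := Suc (ptr m))) (hold(job_of e := Suc e)) stack sp (x(e := q))
    (load(m := load m + q)) (insert (edge e) P)"
proof -
  have inv: "proposal_invariant I P" and ptr: "pointers_ok ptr P" and hold: "holds_ok hold P"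
    and loads: "loads_ok x load P" and stack: "stack_ok ptr stack sp load"
    using st by (auto simp: proposal_state_def)
  have act: "m \<in> active" using m stack by (auto simp: stack_ok_def)
  note np = next_proposal[OF inv ptr loads act load more, folded e]
  have edge: "edge e = (jn (job_of e), mn m)" using np(2) by (simp add: edge_at_def)
  have E: "(jn (job_of e), mn m) \<in> edges I" using edge_in[OF np(1)] edge by simp
  note none = hold_no_proposal[OF inv hold np(1) free]
  have heldQ: "held I (insert (edge e) P) = insert (edge e) (held I P)"
    using held_insert_new[OF E none] edge by simp
  have HA: "held_assignment I (insert (edge e) P) = (held_assignment I P)(edge e := q)"
    using held_assignment_insert_new[OF E none] edge q by simp
  have "held_assignment I P (edge e) = 0"
    using np(3) held_subset by (auto simp: held_assignment_def)
  then have total: "machine_total I (held_assignment I (insert (edge e) P)) m' =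
      machine_total I (held_assignment I P) m' + (if m' = mn m then q else 0)" for m'
    using machine_total_upd[OF E] HA edge by simp
  have "holds_ok (hold(job_of e := Suc e)) (insert (edge e) P)"
    by (rule holds_ok_accept[OF hold np(1)]) (auto simp: heldQ)
  moreover have "loads_ok (x(e := q)) (load(m := load m + q)) (insert (edge e) P)"
    using loads np(1,2) HA total mn_eq_iff by (auto simp: loads_ok_def edge_eq_iff)
  moreover have "stack_ok (ptr(m := Suc (ptr m))) stack sp (load(m := load m + q))"
    using stack m by (auto simp: stack_ok_def)
  ultimately show ?thesis using np by (simp add: proposal_state_def)
qed

text \<open>The machine that loses the job has its load reduced and may be able to propose again,
  hence it is pushed.\<close>

lemma proposal_state_better:
  assumes st: "proposal_state ptr hold stack sp x load P"
    and m: "m \<in> stack ` {..<sp}" and load: "load m < mcap I (mn m)" and more: "ptr m < moff (Suc m)"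
    and e: "e = mlst (ptr m)" and old: "hold (job_of e) = Suc old"
    and better: "(mn m, mn (mach_of old)) \<in> jpref I (jn (job_of e))"
    and q: "q = jsize I (jn (job_of e))"
  shows "mach_of old \<noteq> m"
    "proposal_state (ptr(m := Suc (ptr m))) (hold(job_of e := Suc e)) (stack(sp := mach_of old)) (Suc sp)
      (x(old := 0, e := q)) (load(mach_of old := load (mach_of old) - q, m := load m + q))
      (insert (edge e) P)"
proof -
  have inv: "proposal_invariant I P" and ptr: "pointers_ok ptr P" and hold: "holds_ok hold P"
    and loads: "loads_ok x load P" and stack: "stack_ok ptr stack sp load"
    using st by (auto simp: proposal_state_def)
  have P: "P \<subseteq> edges I" using inv by (simp add: proposal_invariant_def)
  have act: "m \<in> active" using m stack by (auto simp: stack_ok_def)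
  note np = next_proposal[OF inv ptr loads act load more, folded e]
  have edge: "edge e = (jn (job_of e), mn m)" using np(2) by (simp add: edge_at_def)
  have E: "(jn (job_of e), mn m) \<in> edges I" using edge_in[OF np(1)] edge by simp
  have old': "old < ne" "job_of old = job_of e" "edge old \<in> held I P"
    using holds_ok_held[OF hold np(1) old] by blast+
  then have edge_old: "edge old = (jn (job_of e), mn (mach_of old))" by (simp add: edge_at_def)
  have Eold: "(jn (job_of e), mn (mach_of old)) \<in> edges I"
    using edge_in[OF old'(1)] edge_old by simp
  have h: "(jn (job_of e), mn (mach_of old)) \<in> held I P" using old'(3) edge_old by simp
  \<comment> \<open>The two load updates therefore affect different cells and do not
    interfere.\<close>
  show ne: "mach_of old \<noteq> m"
    using better strict_preference_on_irrefl[OF job_order] edges_subset[OF E] by metis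
  then have mn_ne: "mn (mach_of old) \<noteq> mn m" using mn_eq_iff[OF old'(1) np(1)] np(2) by simp
  have heldQ: "held I (insert (edge e) P) = insert (edge e) (held I P - {edge old})"
    using held_insert_better[OF P h better] edge edge_old by simp
  have HA: "held_assignment I (insert (edge e) P) = (held_assignment I P)(edge old := 0, edge e := q)"
    using held_assignment_insert_better[OF P h better] edge edge_old q by simp
  have z: "held_assignment I P (edge e) = 0" "held_assignment I P (edge old) = q"
    using np(3) held_subset old'(3) q edge_old by (auto simp: held_assignment_def)
  have total: "machine_total I (held_assignment I (insert (edge e) P)) m' =
      machine_total I (held_assignment I P) m' + (if m' = mn m then q else 0)
        - (if m' = mn (mach_of old) then q else 0)" for m'
    using machine_total_upd[OF E] machine_total_upd[OF Eold] HA z edge edge_old mn_ne by auto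
  have "holds_ok (hold(job_of e := Suc e)) (insert (edge e) P)"
    by (rule holds_ok_accept[OF hold np(1)]) (use old' in \<open>auto simp: heldQ edge_eq_iff\<close>)
  moreover have "loads_ok (x(old := 0, e := q))
      (load(mach_of old := load (mach_of old) - q, m := load m + q)) (insert (edge e) P)"
    using loads np(1,2) HA total mn_eq_iff old' ne by (auto simp: loads_ok_def edge_eq_iff)
  moreover have "stack_ok (ptr(m := Suc (ptr m))) (stack(sp := mach_of old)) (Suc sp)
      (load(mach_of old := load (mach_of old) - q, m := load m + q))"
  proof -
    have "(stack(sp := mach_of old)) ` {..<Suc sp} = insert (mach_of old) (stack ` {..<sp})"
      by (auto simp: lessThan_Suc)
    then show ?thesis using stack m old'(1) by (auto simp: stack_ok_def simp del: fun_upd_apply)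
        (auto split: if_splits)
  qed
  ultimately show "proposal_state (ptr(m := Suc (ptr m))) (hold(job_of e := Suc e))
      (stack(sp := mach_of old)) (Suc sp) (x(old := 0, e := q))
      (load(mach_of old := load (mach_of old) - q, m := load m + q)) (insert (edge e) P)"
    using np by (simp add: proposal_state_def)
qed

text \<open>The new edge joins \<open>P\<close> as a rejected one, so only the pointer
  moves.\<close>

lemma proposal_state_worse:
  assumes st: "proposal_state ptr hold stack sp x load P"
    and m: "m \<in> stack ` {..<sp}" and load: "load m < mcap I (mn m)" and more: "ptr m < moff (Suc m)"
    and e: "e = mlst (ptr m)" and old: "hold (job_of e) = Suc old"
    and worse: "(mn (mach_of old), mn m) \<in> jpref I (jn (job_of e))"
  shows "proposal_state (ptr(m := Suc (ptr m))) hold stack sp x load (insert (edge e) P)"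
proof -
  have inv: "proposal_invariant I P" and ptr: "pointers_ok ptr P" and hold: "holds_ok hold P"
    and loads: "loads_ok x load P" and stack: "stack_ok ptr stack sp load"
    using st by (auto simp: proposal_state_def)
  have P: "P \<subseteq> edges I" using inv by (simp add: proposal_invariant_def)
  have act: "m \<in> active" using m stack by (auto simp: stack_ok_def)
  note np = next_proposal[OF inv ptr loads act load more, folded e]
  have edge: "edge e = (jn (job_of e), mn m)" using np(2) by (simp add: edge_at_def)
  have old': "old < ne" "job_of old = job_of e" "edge old \<in> held I P"
    using holds_ok_held[OF hold np(1) old] by blast+
  then have h: "(jn (job_of e), mn (mach_of old)) \<in> held I P" by (simp add: edge_at_def)
  have heldQ: "held I (insert (edge e) P) = held I P"
    using held_insert_worse[OF P h worse] edge by simp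
  have HA: "held_assignment I (insert (edge e) P) = held_assignment I P"
    using held_assignment_insert_worse[OF P h worse] edge by simp
  have "edge e' \<notin> insert (edge e) P" if "e' < ne" "hold (job_of e') = 0" for e'
    using that holds_ok_free[OF hold that] old edge_eq_iff[OF that(1) np(1)] by auto
  then have "holds_ok hold (insert (edge e) P)"
    unfolding holds_ok_def heldQ using holds_ok_held[OF hold] by blast
  moreover have "loads_ok x load (insert (edge e) P)"
    using loads HA by (simp add: loads_ok_def)
  moreover have "stack_ok (ptr(m := Suc (ptr m))) stack sp load"
    using stack m by (auto simp: stack_ok_def)
  ultimately show ?thesis using np by (simp add: proposal_state_def)
qed

text \<open>The popped machine is saturated or exhausted, and \<open>stack_ok\<close> demands
  nothing for such a machine.\<close>

lemma proposal_state_pop: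
  assumes st: "proposal_state ptr hold stack (Suc sp) x load P"
    and sat: "\<not> (load (stack sp) < mcap I (mn (stack sp)) \<and> ptr (stack sp) < moff (Suc (stack sp)))"
  shows "proposal_state ptr hold stack sp x load P"
  using assms by (auto simp: proposal_state_def stack_ok_def lessThan_Suc)

text \<open>With an empty stack, \<open>stack_ok\<close> says that no machine can propose, which is
  the finality condition of \<open>machine_optimal_held_assignment\<close>.\<close>

lemma proposal_state_final:
  assumes st: "proposal_state ptr hold stack 0 x load P"
  shows "machine_optimal I (held_assignment I P)"
proof (rule machine_optimal_held_assignment)
  show "proposal_invariant I P" using st by (simp add: proposal_state_def)
  fix m assume "m \<in> machines I" and l: "machine_total I (held_assignment I P) m < mcap I m"
  show "{e \<in> edges I. snd e = m} \<subseteq> P"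
  proof
    fix a assume "a \<in> {e \<in> edges I. snd e = m}"
    then obtain e where e: "e < ne" "edge e = a" "mn (mach_of e) = m"
      by (auto elim!: edge_number simp: edge_at_def)
    then have act: "mach_of e \<in> active" by simp
    then have "load (mach_of e) < mcap I (mn (mach_of e))"
      using st l e(3) by (auto simp: proposal_state_def loads_ok_def)
    then have "\<not> ptr (mach_of e) < moff (Suc (mach_of e))"
      using st act by (auto simp: proposal_state_def stack_ok_def)
    moreover obtain p where "moff (mach_of e) \<le> p" "p < moff (Suc (mach_of e))" "mlst p = e"
      using ml.lst_position[OF e(1)] .
    ultimately show "a \<in> P" using st act e(2) by (force simp: proposal_state_def pointers_ok_def)
  qed
qed

text \<open>The initial stack is a copy of the array of machine end points, with one entry per edge;
  hence its height is \<open>ne\<close>.\<close>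

lemma proposal_state_init:
  assumes "\<And>e. e < ne \<Longrightarrow> ptr (mach_of e) = moff (mach_of e) \<and> load (mach_of e) = 0 \<and>
    hold (job_of e) = 0 \<and> x e = 0 \<and> stack e = mach_of e"
  shows "proposal_state ptr hold stack ne x load {}"
proof -
  have "held_assignment I {} = (\<lambda>e. 0)" by (auto simp: held_assignment_def held_def)
  moreover have "stack ` {..<ne} = active" using assms by (intro image_cong) auto
  ultimately show ?thesis
    using assms proposal_invariant_empty end_bounds ml.off_Suc
    by (auto simp: proposal_state_def pointers_ok_def holds_ok_def loads_ok_def stack_ok_def
        machine_total_def)
qed

end

text \<open>
  Working storage of the program:

  \<^item> naturals, array 7: position of each edge in the incidence list of its job
  \<^item> naturals, array 8: position of the next proposal of each machine in array 4
  \<^item> naturals, array 9: successor of the edge held by each job, 0 if there is none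
  \<^item> naturals, array 10: the stack, of height \<open>counter\<close> (which also drives the first loop)
  \<^item> reals, array 3: load of each machine

  There may be far more machines than edges, since machines can be isolated. So the first loop
  runs over the edges and initialises only the machines that occur in them; the same machine may
  then lie on the stack several times.
\<close>

abbreviation counter :: nexp where "counter \<equiv> NCell 11 (NConst 0)"
abbreviation cur_machine :: nexp where "cur_machine \<equiv> NCell 11 (NConst 1)"
abbreviation cur_edge :: nexp where "cur_edge \<equiv> NCell 11 (NConst 2)"
abbreviation cur_job :: nexp where "cur_job \<equiv> NCell 5 cur_edge"
abbreviation old_edge :: nexp where "old_edge \<equiv> NPred (NCell 9 cur_job)"
abbreviation old_machine :: nexp where "old_machine \<equiv> NCell 6 old_edge"

text \<open>The counter is a list position in the first store, which builds the ranks, and an edge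
  number in the following ones. A vertex is reset once for each of its edges, always to the same
  values.\<close>

definition init_body :: com where
  "init_body =
    Seq (NStore 7 (NCell 2 counter) counter)
    (Seq (NStore 8 (NCell 6 counter) (NCell 3 (NCell 6 counter)))
    (Seq (RStore 3 (NCell 6 counter) RZero)
    (Seq (NStore 9 (NCell 5 counter) (NConst 0))
    (Seq (RStore 2 counter RZero)
    (Seq (NStore 10 counter (NCell 6 counter))
      (NStore 11 (NConst 0) (NSucc counter)))))))"

definition accept :: com where
  "accept =
    Seq (RStore 3 cur_machine (RAdd (RCell 3 cur_machine) (RCell 0 cur_job)))
    (Seq (RStore 2 cur_edge (RCell 0 cur_job))
      (NStore 9 cur_job (NSucc cur_edge)))"

text \<open>To be run before \<open>accept\<close>, which overwrites the cell of array 9 from which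
  \<open>old_edge\<close> is read.\<close>

definition displace :: com where
  "displace =
    Seq (RStore 2 old_edge RZero)
    (Seq (RStore 3 old_machine (RSub (RCell 3 old_machine) (RCell 0 cur_job)))
    (Seq (NStore 10 counter old_machine)
      (NStore 11 (NConst 0) (NSucc counter))))"

text \<open>The top machine is only inspected at first; it is popped when it cannot propose.
  Comparison with \<open>NConst 1\<close> tests whether the job is free.\<close>

definition proposal_body :: com where
  "proposal_body =
    Seq (NStore 11 (NConst 1) (NCell 10 (NPred counter)))
    (Cond (BAnd (RLess (RCell 3 cur_machine) (RCell 1 cur_machine))
                (NLess (NCell 8 cur_machine) (NCell 3 (NSucc cur_machine))))
      (Seq (NStore 11 (NConst 2) (NCell 4 (NCell 8 cur_machine)))
      (Seq (NStore 8 cur_machine (NSucc (NCell 8 cur_machine)))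
        (Cond (NLess (NCell 9 cur_job) (NConst 1))
          accept
          (Cond (NLess (NCell 7 cur_edge) (NCell 7 old_edge))
            (Seq displace accept)
            Skip))))
      (NStore 11 (NConst 0) (NPred counter)))"

abbreviation init_guard :: bexp where "init_guard \<equiv> NLess counter (NCell 0 (NConst 2))"
abbreviation proposal_guard :: bexp where "proposal_guard \<equiv> NLess (NConst 0) counter"

text \<open>The first loop ends with the counter equal to the number of edges, which is also the
  height of the stack it has built; so the second loop can start at once.\<close>

definition deferred_acceptance :: com where
  "deferred_acceptance = Seq (NStore 11 (NConst 0) (NConst 0))
    (Seq (While init_guard init_body) (While proposal_guard proposal_body))"

section \<open>Correctness and running time of the program\<close>

context representation
begin

text \<open>These are the arrays that hold the input; the program stores only to arrays with larger
  numbers.\<close>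

definition input_kept :: "mem \<Rightarrow> bool" where
  "input_kept s \<longleftrightarrow> (\<forall>a<7. nmem s a = nmem s0 a) \<and> (\<forall>a<2. rmem s a = rmem s0 a)"

definition init_inv :: "nat \<Rightarrow> mem \<Rightarrow> bool" where
  "init_inv n s \<longleftrightarrow> input_kept s \<and> n + nmem s 11 0 = ne \<and>
     (\<forall>e<nmem s 11 0. nmem s 7 (jlst e) = e \<and> nmem s 8 (mach_of e) = moff (mach_of e) \<and>
        rmem s 3 (mach_of e) = 0 \<and> nmem s 9 (job_of e) = 0 \<and> rmem s 2 e = 0 \<and>
        nmem s 10 e = mach_of e)"

lemma init_body_step:
  assumes inv: "init_inv n s" and b: "nmem s 11 0 < ne"
  shows "\<exists>n'<n. init_inv n' (run init_body s)"
proof -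
  let ?i = "nmem s 11 0"
  have kept: "\<And>a. a < 7 \<Longrightarrow> nmem s a = nmem s0 a" "\<And>a. a < 2 \<Longrightarrow> rmem s a = rmem s0 a"
    using inv by (auto simp: init_inv_def input_kept_def)
  \<comment> \<open>Job lists repeat no edge, so the store to array 7 leaves the earlier ranks
    intact.\<close>
  have inj: "jlst e \<noteq> jlst ?i" if "e < ?i" for e
    using that b jl.inj_on_lst by (auto simp: inj_on_def)
  have "init_inv (n - 1) (run init_body s)"
    using inv b inj
    by (auto simp: init_inv_def input_kept_def init_body_def kept less_Suc_eq)
  moreover have "n - 1 < n" using inv b by (auto simp: init_inv_def)
  ultimately show ?thesis by blast
qed

text \<open>The set \<open>P\<close> is a ghost variable: memory represents it only through the
  pointers.\<close>

definition proposal_inv :: "nat \<Rightarrow> mem \<Rightarrow> bool" where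
  "proposal_inv n s \<longleftrightarrow> input_kept s \<and> ranks (nmem s 7) \<and>
     (\<exists>P. proposal_state (nmem s 8) (nmem s 9) (nmem s 10) (nmem s 11 0) (rmem s 2) (rmem s 3) P \<and>
        n = 2 * (ne - card P) + nmem s 11 0)"

text \<open>Subtraction on naturals truncates; it is exact here because sets of proposals consist of
  edges.\<close>

lemma card_insert_proposal:
  assumes "P \<subseteq> edges I" "a \<in> edges I" "a \<notin> P"
  shows "ne - card P = Suc (ne - card (insert a P))"
proof -
  have fin: "finite P" using assms finite_edges finite_subset by blast
  have "card (insert a P) \<le> ne"
    using assms card_mono[OF finite_edges, of "insert a P"] card_edges by simp
  then show ?thesis using assms(3) fin by simp
qed

text \<open>The variant drops by 1 for a pop, by 2 for a proposal that pushes nothing, and by 2 - 1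
  = 1 for a displacement.\<close>

lemma proposal_body_step:
  assumes inv: "proposal_inv n s" and b: "0 < nmem s 11 0"
  shows "\<exists>n'<n. proposal_inv n' (run proposal_body s)"
proof -
  define sp where "sp = nmem s 11 0"
  define m where "m = nmem s 10 (sp - 1)"
  define e where "e = mlst (nmem s 8 m)"
  let ?j = "job_of e"
  let ?s = "run proposal_body s"
  have kept: "\<And>a. a < 7 \<Longrightarrow> nmem s a = nmem s0 a" "\<And>a. a < 2 \<Longrightarrow> rmem s a = rmem s0 a"
    and rk: "ranks (nmem s 7)"
    using inv by (auto simp: proposal_inv_def input_kept_def)
  obtain P where st: "proposal_state (nmem s 8) (nmem s 9) (nmem s 10) sp (rmem s 2) (rmem s 3) P"
    and n: "n = 2 * (ne - card P) + sp"
    using inv by (auto simp: proposal_inv_def sp_def)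
  have sp: "0 < sp" using b by (simp add: sp_def)
  then have top: "m \<in> nmem s 10 ` {..<sp}" by (simp add: m_def)
  have act: "m \<in> active" using top st by (auto simp: proposal_state_def stack_ok_def)
  then have nm: "m < nm" using end_bounds by auto
  have simps: "nmem s 11 0 = sp" "nmem s 10 (sp - Suc 0) = m" "mlst (nmem s 8 m) = e"
    "rmem s0 (Suc 0) m = mcap I (mn m)"
    using rmem_mcap[OF nm] unfolding sp_def m_def e_def by simp_all
  show ?thesis
  proof (cases "rmem s 3 m < mcap I (mn m) \<and> nmem s 8 m < moff (Suc m)")
    case False
    have "proposal_state (nmem s 8) (nmem s 9) (nmem s 10) (sp - 1) (rmem s 2) (rmem s 3) P"
      by (rule proposal_state_pop) (use st False sp in \<open>auto simp: m_def\<close>)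
    then have "proposal_inv (n - 1) ?s"
      using False kept rk n sp
      by (auto simp: proposal_inv_def input_kept_def proposal_body_def simps)
    then show ?thesis using n sp by (intro exI[of _ "n - 1"]) simp
  next
    case True
    then have load: "rmem s 3 m < mcap I (mn m)" and more: "nmem s 8 m < moff (Suc m)" by auto
    have parts: "proposal_invariant I P" "pointers_ok (nmem s 8) P" "holds_ok (nmem s 9) P"
      "loads_ok (rmem s 2) (rmem s 3) P"
      using st by (auto simp: proposal_state_def)
    note np = next_proposal[OF parts(1,2,4) act load more, folded e_def]
    have j: "rmem s0 0 ?j = jsize I (jn ?j)" using rmem_jsize end_bounds np(1) by blast
    have card: "ne - card P = Suc (ne - card (insert (edge e) P))"
      using card_insert_proposal parts(1) edge_in np(1,3) by (auto simp: proposal_invariant_def)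
    show ?thesis
    proof (cases "nmem s 9 ?j")
      case 0
      have "proposal_inv (n - 2) ?s"
        using True 0 kept rk n card proposal_state_new[OF st top load more e_def 0 refl]
        by (auto simp: proposal_inv_def input_kept_def proposal_body_def accept_def simps j)
      then show ?thesis using n card by (intro exI[of _ "n - 2"]) simp
    next
      case (Suc old)
      have old: "old < ne" "job_of old = ?j" "edge old \<in> held I P"
        using holds_ok_held[OF parts(3) np(1) Suc] by blast+
      show ?thesis
      proof (cases "nmem s 7 e < nmem s 7 old")
        case rank: True
        have better: "(mn m, mn (mach_of old)) \<in> jpref I (jn ?j)"
          using ranks_less[OF rk np(1) old(1) _ rank] old(2) np(2) by simp
        note new = proposal_state_better[OF st top load more e_def Suc better refl]
        have "proposal_inv (n - 1) ?s"
          using True Suc rank kept rk n card new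
          by (auto simp: proposal_inv_def input_kept_def proposal_body_def accept_def displace_def simps j)
        then show ?thesis using n card by (intro exI[of _ "n - 1"]) simp
      next
        case rank: False
        \<comment> \<open>One edge is held and the other is new, so they differ and so do their
          ranks; a failed comparison then means that the old edge ranks strictly better.\<close>
        have "old \<noteq> e" using old(3) np(3) held_subset by blast
        then have "nmem s 7 old < nmem s 7 e"
          using rank ranks_inj[OF rk old(1) np(1)] by force
        then have worse: "(mn (mach_of old), mn m) \<in> jpref I (jn ?j)"
          using ranks_less[OF rk old(1) np(1) old(2)] old(2) np(2) by simp
        have "proposal_inv (n - 2) ?s"
          using True Suc rank kept rk n card proposal_state_worse[OF st top load more e_def Suc worse]
          by (auto simp: proposal_inv_def input_kept_def proposal_body_def simps)
        then show ?thesis using n card by (intro exI[of _ "n - 2"]) simp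
      qed
    qed
  qed
qed

lemma deferred_acceptance_correct:
  "\<exists>t s' x. exec deferred_acceptance s0 t s' \<and>
     t \<le> 3 + (ne + 1) * (bcost init_guard + time_bound init_body + 1)
       + (3 * ne + 1) * (bcost proposal_guard + time_bound proposal_body + 1) \<and>
     machine_optimal I x \<and> delivers I jn mn s0 s' x"
proof -
  let ?s1 = "nupd 11 0 0 s0"
  have e1: "exec (NStore 11 (NConst 0) (NConst 0)) s0 3 ?s1"
    using exec_NStore[of 11 "NConst 0" "NConst 0" s0] by (simp add: numeral_3_eq_3)
  have "\<exists>t s' n'. exec (While init_guard init_body) ?s1 t s' \<and> init_inv n' s' \<and>
      \<not> bval init_guard s' \<and> t \<le> (ne + 1) * (bcost init_guard + time_bound init_body + 1)"
  proof (rule exec_While)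
    show "init_inv ne ?s1" by (simp add: init_inv_def input_kept_def)
    show "\<exists>n'<n. init_inv n' (run init_body s)" if "init_inv n s" "bval init_guard s" for n s
      using that by (intro init_body_step) (auto simp: init_inv_def input_kept_def)
  qed (simp add: init_body_def)
  then obtain t2 s2 n2 where e2: "exec (While init_guard init_body) ?s1 t2 s2"
    and inv2: "init_inv n2 s2" and b2: "\<not> bval init_guard s2"
    and t2: "t2 \<le> (ne + 1) * (bcost init_guard + time_bound init_body + 1)"
    by blast
  have n2: "nmem s2 11 0 = ne" using inv2 b2 by (auto simp: init_inv_def input_kept_def)
  have "proposal_state (nmem s2 8) (nmem s2 9) (nmem s2 10) ne (rmem s2 2) (rmem s2 3) {}"
    using inv2 n2 by (intro proposal_state_init) (simp add: init_inv_def)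
  \<comment> \<open>Here \<open>3 * ne\<close> is twice the \<open>ne\<close> unproposed edges plus
    the initial stack height \<open>ne\<close>.\<close>
  then have start: "proposal_inv (3 * ne) s2"
    using inv2 n2 unfolding proposal_inv_def init_inv_def ranks_def by fastforce
  have "\<exists>t s' n'. exec (While proposal_guard proposal_body) s2 t s' \<and> proposal_inv n' s' \<and>
      \<not> bval proposal_guard s' \<and>
      t \<le> (3 * ne + 1) * (bcost proposal_guard + time_bound proposal_body + 1)"
  proof (rule exec_While)
    show "\<exists>n'<n. proposal_inv n' (run proposal_body s)"
      if "proposal_inv n s" "bval proposal_guard s" for n s
      using that by (intro proposal_body_step) auto
  qed (simp_all add: start proposal_body_def accept_def displace_def)
  then obtain t3 s3 n3 where e3: "exec (While proposal_guard proposal_body) s2 t3 s3"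
    and inv3: "proposal_inv n3 s3" and b3: "\<not> bval proposal_guard s3"
    and t3: "t3 \<le> (3 * ne + 1) * (bcost proposal_guard + time_bound proposal_body + 1)"
    by blast
  obtain P where P: "proposal_state (nmem s3 8) (nmem s3 9) (nmem s3 10) 0 (rmem s3 2) (rmem s3 3) P"
    using inv3 b3 by (auto simp: proposal_inv_def)
  have "exec deferred_acceptance s0 (3 + (t2 + t3)) s3"
    unfolding deferred_acceptance_def using e1 e2 e3 by (intro exec_Seq)
  moreover have "machine_optimal I (held_assignment I P)" using proposal_state_final[OF P] .
  moreover have "delivers I jn mn s0 s3 (held_assignment I P)"
    using P card_edges by (auto simp: delivers_def proposal_state_def loads_ok_def)
  moreover have "3 + (t2 + t3) \<le> 3 + (ne + 1) * (bcost init_guard + time_bound init_body + 1)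
      + (3 * ne + 1) * (bcost proposal_guard + time_bound proposal_body + 1)"
    using add_mono[OF t2 t3] by linarith
  ultimately show ?thesis by blast
qed

end

theorem theorem2:
  "(\<forall>I :: ('j, 'm) problem. valid_problem I \<longrightarrow> (\<exists>x. machine_optimal I x)) \<and>
   (\<exists>(prog :: com) (T :: nat \<Rightarrow> nat).
      (\<lambda>n. real (T n)) \<in> O(\<lambda>n. real n) \<and>
      (\<forall>(I :: ('j, 'm) problem) jn mn s. valid_problem I \<and> represents I jn mn s \<longrightarrow>
         (\<exists>t s' x. exec prog s t s' \<and> t \<le> T (card (edges I)) \<and>
            machine_optimal I x \<and> delivers I jn mn s s' x)))"
proof (intro conjI allI impI)
  fix I :: "('j, 'm) problem"
  assume "valid_problem I"
  then interpret valid_instance I by unfold_locales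
  show "\<exists>x. machine_optimal I x" by (rule machine_optimal_exists)
next
  \<comment> \<open>The costs \<open>a\<close> and \<open>b\<close> of one iteration of each loop
    depend on the program text alone, so a single \<open>T\<close> serves all instances.\<close>
  define a where "a = bcost init_guard + time_bound init_body + 1"
  define b where "b = bcost proposal_guard + time_bound proposal_body + 1"
  define T where "T n = 3 + (n + 1) * a + (3 * n + 1) * b" for n :: nat
  have "(\<lambda>n. real (T n)) \<in> O(\<lambda>n. real n)"
  proof (rule bigoI)
    show "\<forall>\<^sub>F n in at_top. norm (real (T n)) \<le> real (3 + 2 * a + 4 * b) * norm (real n)"
    proof (rule eventually_at_top_linorderI[of 1])
      fix n :: nat assume n: "1 \<le> n"
      \<comment> \<open>For \<open>n\<close> at least 1, every additive constant is absorbed into a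
        multiple of \<open>n\<close>.\<close>
      have "T n \<le> 3 * n + (n + n) * a + (3 * n + n) * b"
        unfolding T_def using n by (intro add_mono mult_right_mono) auto
      also have "\<dots> = (3 + 2 * a + 4 * b) * n" by (simp add: algebra_simps)
      finally show "norm (real (T n)) \<le> real (3 + 2 * a + 4 * b) * norm (real n)"
        by (simp only: norm_of_nat of_nat_le_iff flip: of_nat_mult)
    qed
  qed
  moreover have "\<exists>t s' x. exec deferred_acceptance s t s' \<and> t \<le> T (card (edges I)) \<and>
      machine_optimal I x \<and> delivers I jn mn s s' x"
    if "valid_problem I \<and> represents I jn mn s" for I :: "('j, 'm) problem" and jn mn s
  proof -
    interpret representation I jn mn s using that by unfold_locales auto
    show ?thesis using deferred_acceptance_correct unfolding T_def a_def b_def card_edges .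
  qed
  ultimately show "\<exists>(prog :: com) (T :: nat \<Rightarrow> nat).
      (\<lambda>n. real (T n)) \<in> O(\<lambda>n. real n) \<and>
      (\<forall>(I :: ('j, 'm) problem) jn mn s. valid_problem I \<and> represents I jn mn s \<longrightarrow>
         (\<exists>t s' x. exec prog s t s' \<and> t \<le> T (card (edges I)) \<and>
            machine_optimal I x \<and> delivers I jn mn s s' x))"
    by blast
qed

end
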